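(* Let $\mathcal{H}$ be a separable (real) Hilbert space, $T>0$, $m\in\mathbb{N}$, and let $(u,b):[0,T]\to\mathcal{H}^m\times\mathbb{R}^m$ be a Lipschitz continuous control such that the moving polyhedron $C_{(u,b)}(t)=\{x\in\mathcal{H}\mid\langle u_i(t),x\rangle\le b_i(t),\ i=1,\dots,m\}$ satisfies the uniform Slater condition: for every $t\in[0,T]$ there exists $x\in\mathcal{H}$ with $\langle u_i(t),x\rangle<b_i(t)$ for all $i=1,\dots,m$. Let $x_0\in C_{(u,b)}(0)$. Then the sweeping process $$-\dot x(t)\in N_{C_{(u,b)}(t)}(x(t))\ \text{ for a.e. } t\in[0,T],\qquad x(0)=x_0,$$ admits a unique Lipschitz continuous solution $x:[0,T]\to\mathcal{H}$.
   Context: For a convex set $C\subseteq\mathcal{H}$, $N_C(x):=\{v\in\mathcal{H}\mid\langle v,y-x\rangle\le 0\ \forall y\in C\}$ if $x\in C$, and $N_C(x):=\emptyset$ if $x\notin C$. A solution of the sweeping process is required to satisfy the (hidden) state constraint $x(t)\in C_{(u,b)}(t)$ for all $t\in[0,T]$. *)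

theory Defs
  imports "HOL-Analysis.Analysis"
begin

definition normal_cone :: "'a::real_inner set \<Rightarrow> 'a \<Rightarrow> 'a set" where
  "normal_cone C x = (if x \<in> C then {v. \<forall>y\<in>C. v \<bullet> (y - x) \<le> 0} else {})"

definition moving_polyhedron ::
    "(real \<Rightarrow> 'a::real_inner ^ 'm) \<Rightarrow> (real \<Rightarrow> real ^ 'm) \<Rightarrow> real \<Rightarrow> 'a set" where
  "moving_polyhedron u b t = {x. \<forall>i. u t $ i \<bullet> x \<le> b t $ i}"

definition uniform_slater ::
    "real \<Rightarrow> (real \<Rightarrow> 'a::real_inner ^ 'm) \<Rightarrow> (real \<Rightarrow> real ^ 'm) \<Rightarrow> bool" where
  "uniform_slater T u b \<longleftrightarrow> (\<forall>t\<in>{0..T}. \<exists>x. \<forall>i. u t $ i \<bullet> x < b t $ i)"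

(* Functions on the interval [0,T] are represented by total functions whose values outside
   [0,T] are irrelevant; hence the derivative is taken within [0,T].  The state constraint
   is required at every time, the differential inclusion only almost everywhere. *)
definition sweeping_solution ::
    "real \<Rightarrow> (real \<Rightarrow> 'a::real_inner set) \<Rightarrow> 'a \<Rightarrow> (real \<Rightarrow> 'a) \<Rightarrow> bool" where
  "sweeping_solution T C x0 x \<longleftrightarrow>
     x 0 = x0 \<and>
     (\<forall>t\<in>{0..T}. x t \<in> C t) \<and>
     (AE t\<in>{0..T} in lebesgue.
        \<exists>x'. (x has_vector_derivative x') (at t within {0..T}) \<and>
             - x' \<in> normal_cone (C t) (x t))"

end

theory Submission
  imports Defs "HOL-Complex_Analysis.Great_Picard"
begin

text \<open>
  On a short time interval one point \<open>z\<close> satisfies the Slater condition with a uniform margin. There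
  the explicit scheme \<open>x\<^sub>k\<^sub>+\<^sub>1 = x\<^sub>k - \<alpha> \<Sum>\<^sub>i p\<^sub>i u\<^sub>i\<close>, with \<open>p\<^sub>i\<close> the violation of the \<open>i\<close>-th constraint at
  time \<open>t\<^sub>k\<close>, never moves away from \<open>z\<close>, and each step contracts the violation by a fixed factor; since
  moving on in time by \<open>h\<close> adds only \<open>O(h)\<close>, the violation stays \<open>O(h)\<close>. The accumulated multipliers
  \<open>\<Lambda>\<^sub>i\<close> are therefore nondecreasing and Lipschitz up to \<open>O(h)\<close>, and a subsequence converges pointwise.
  As \<open>u\<close> is Lipschitz, \<open>x(t) = x(s) - \<Sum>\<^sub>i (\<Lambda>\<^sub>i(t) - \<Lambda>\<^sub>i(s)) u\<^sub>i(s) + O((t - s)\<^sup>2)\<close> uniformly in \<open>h\<close>, so the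
  iterates converge strongly as well, and the limit is differentiable wherever the scalar functions
  \<open>\<Lambda>\<^sub>i\<close> are, that is almost everywhere, with \<open>-x' = \<Sum>\<^sub>i \<Lambda>\<^sub>i' u\<^sub>i\<close>. Complementarity passes to the limit and
  puts \<open>-x'\<close> into the normal cone. Local solutions are glued by Bolzano's bisection principle. For
  uniqueness, \<open>\<parallel>x - y\<parallel>\<^sup>2\<close> is Lipschitz with almost everywhere nonpositive derivative.
\<close>

section \<open>Almost everywhere differentiability of monotone Lipschitz functions\<close>

text \<open>The covering theorem for closed balls allows off-centre points, so a point of
  \<open>S\<close> may sit anywhere in its interval. Staying inside \<open>U\<close> only takes a
  smaller \<open>d\<close> in \<open>fine\<close>.\<close>

lemma Vitali_covering_intervals:
  fixes S U :: "real set" and P :: "real \<Rightarrow> real \<Rightarrow> bool"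
  assumes "open U" "S \<subseteq> U"
    and fine: "\<And>t d. t \<in> S \<Longrightarrow> 0 < d \<Longrightarrow> \<exists>l r. l < r \<and> t \<in> {l..r} \<and> r - l < d \<and> P l r"
  obtains C where "countable C" "\<forall>(l, r)\<in>C. l < r \<and> P l r \<and> {l..r} \<subseteq> U"
    "disjoint_family_on (\<lambda>(l, r). {l..r}) C" "negligible (S - (\<Union>(l, r)\<in>C. {l..r}))"
proof -
  define K where "K = {(l, r). l < r \<and> P l r \<and> {l..r} \<subseteq> U}"
  define m :: "real \<times> real \<Rightarrow> real" where "m = (\<lambda>(l, r). (l + r) / 2)"
  define \<rho> :: "real \<times> real \<Rightarrow> real" where "\<rho> = (\<lambda>(l, r). (r - l) / 2)"
  have cball: "cball (m i) (\<rho> i) = (case i of (l, r) \<Rightarrow> {l..r})" for i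
    by (auto simp: m_def \<rho>_def cball_eq_atLeastAtMost field_simps split: prod.splits)
  have "0 < \<rho> i" if "i \<in> K" for i
    using that by (auto simp: K_def \<rho>_def)
  moreover have "\<exists>i. i \<in> K \<and> t \<in> cball (m i) (\<rho> i) \<and> \<rho> i < d" if t: "t \<in> S" and d: "0 < d" for t d
  proof -
    obtain e where e: "e > 0" "ball t e \<subseteq> U"
      using assms t openE by blast
    obtain l r where lr: "l < r" "t \<in> {l..r}" "r - l < min d e" "P l r"
      using fine[OF t, of "min d e"] d e by auto
    have "{l..r} \<subseteq> ball t e"
      using lr by (auto simp: dist_real_def)
    then show ?thesis
      using lr e unfolding cball by (intro exI[of _ "(l, r)"]) (auto simp: K_def \<rho>_def)
  qed
  ultimately obtain C where C: "countable C" "C \<subseteq> K"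
    "pairwise (\<lambda>i j. disjnt (cball (m i) (\<rho> i)) (cball (m j) (\<rho> j))) C"
    "negligible (S - (\<Union>i\<in>C. cball (m i) (\<rho> i)))"
    by (rule Vitali_covering_theorem_cballs)
  show thesis
  proof (rule that[OF C(1)])
    show "disjoint_family_on (\<lambda>(l, r). {l..r}) C"
      using C(3) unfolding cball pairwise_def disjoint_family_on_def disjnt_def by auto
    show "\<forall>(l, r)\<in>C. l < r \<and> P l r \<and> {l..r} \<subseteq> U"
      using C(2) by (auto simp: K_def)
    show "negligible (S - (\<Union>(l, r)\<in>C. {l..r}))"
      using C(4) unfolding cball .
  qed
qed

text \<open>Double covering: intervals with quotient at most \<open>r\<close> bound the increase of
  \<open>f\<close> by \<open>r\<close> times a measure close to that of \<open>S\<close>; inside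
  them, intervals with quotient at least \<open>R\<close> bound it below by \<open>R\<close> times
  the measure of \<open>S\<close>. As \<open>r < R\<close>, that measure is zero.\<close>

lemma negligible_oscillating_quotients:
  fixes f :: "real \<Rightarrow> real"
  assumes "mono f" and cont: "continuous_on UNIV f" and S: "bounded S" and r: "0 \<le> r" "r < R"
    and small: "\<And>t d. t \<in> S \<Longrightarrow> 0 < d \<Longrightarrow>
      \<exists>a b. a < b \<and> t \<in> {a..b} \<and> b - a < d \<and> f b - f a \<le> r * (b - a)"
    and large: "\<And>t d. t \<in> S \<Longrightarrow> 0 < d \<Longrightarrow>
      \<exists>a b. a < b \<and> t \<in> {a..b} \<and> b - a < d \<and> R * (b - a) \<le> f b - f a"
  shows "negligible S"
proof -
  let ?I = "\<lambda>(l, r). {l..r} :: real set"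
  let ?\<nu> = "emeasure (interval_measure f)" and ?\<mu> = "emeasure lborel"
  have nu: "?\<nu> {a..b} = ennreal (f b - f a)" if "a \<le> b" for a b
    using emeasure_interval_measure_Icc[OF that _ cont] \<open>mono f\<close> by (auto simp: mono_def)
  have sum: "emeasure M (\<Union>(?I ` C)) = (\<integral>\<^sup>+i. emeasure M (?I i) \<partial>count_space C)"
    if "sets M = sets borel" "countable C" "disjoint_family_on ?I C" for M C
    by (rule emeasure_UN_countable) (use that in \<open>simp_all add: split_beta\<close>)
  have fin: "?\<mu> X = ennreal (measure lebesgue X)" if "X \<in> lmeasurable" "X \<in> sets borel" for X
    using emeasure_eq_measure2[OF that(1)] that(2) emeasure_completion[of X lborel] by simp
  \<comment> \<open>\<open>S\<close> is not known to be measurable, so \<open>e\<close> is its outer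
    measure, finite because \<open>S\<close> is bounded.\<close>
  define A where "A = {A \<in> lmeasurable. S \<subseteq> A}"
  define e where "e = Inf (measure lebesgue ` A)"
  have "A \<noteq> {}"
    using S unfolding A_def by (metis (mono_tags, lifting) bounded_subset_cbox_symmetric empty_iff lmeasurable_cbox mem_Collect_eq)
  have e_le: "e \<le> measure lebesgue X" if "X \<in> lmeasurable" "S \<subseteq> X" for X
    unfolding e_def by (rule cInf_lower) (use that in \<open>auto simp: A_def intro!: bdd_belowI[of _ 0]\<close>)
  have e0: "0 \<le> e"
    unfolding e_def by (rule cInf_greatest) (use \<open>A \<noteq> {}\<close> in auto)
  have near: "\<exists>X \<in> lmeasurable. S \<subseteq> X \<and> measure lebesgue X < d" if "e < d" for d
    using cInf_lessD[of "measure lebesgue ` A" d] \<open>A \<noteq> {}\<close> that unfolding e_def A_def by blast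
  have key: "R * e \<le> r * (e + 2 * \<epsilon>)" if \<epsilon>: "\<epsilon> > 0" for \<epsilon>
  proof -
    obtain X where X: "X \<in> lmeasurable" "S \<subseteq> X" "measure lebesgue X < e + \<epsilon>"
      using near[of "e + \<epsilon>"] \<epsilon> by auto
    obtain U where U: "open U" "X \<subseteq> U" "U - X \<in> lmeasurable" "emeasure lebesgue (U - X) < ennreal \<epsilon>"
      using sets_lebesgue_outer_open[of X \<epsilon>] X \<epsilon> by (auto simp: fmeasurableD)
    have "U = X \<union> (U - X)" using U by auto
    then have U_lm: "U \<in> lmeasurable"
      by (metis X(1) U(3) fmeasurable.Un)
    have "measure lebesgue (U - X) < \<epsilon>"
      using U(3,4) \<epsilon> by (simp add: emeasure_eq_measure2 ennreal_less_iff)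
    moreover have "measure lebesgue U \<le> measure lebesgue X + measure lebesgue (U - X)"
      by (metis X(1) U(3) \<open>U = X \<union> (U - X)\<close> fmeasurableD measure_Un_le)
    ultimately have mU: "measure lebesgue U \<le> e + 2 * \<epsilon>"
      using X by linarith
    have lU: "?\<mu> U = ennreal (measure lebesgue U)"
      using U_lm U(1) by (intro fin) auto
    obtain C where C: "countable C" "\<forall>(a, b)\<in>C. a < b \<and> f b - f a \<le> r * (b - a) \<and> {a..b} \<subseteq> U"
      "disjoint_family_on ?I C" "negligible (S - (\<Union>(l, r)\<in>C. {l..r}))"
      by (rule Vitali_covering_intervals[OF U(1) subset_trans[OF X(2) U(2)] small])
    have "?\<nu> (\<Union>(?I ` C)) = (\<integral>\<^sup>+i. ?\<nu> (?I i) \<partial>count_space C)"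
      using C by (intro sum) auto
    also have "\<dots> \<le> (\<integral>\<^sup>+i. ennreal r * ?\<mu> (?I i) \<partial>count_space C)"
    proof (rule nn_integral_mono)
      fix i assume "i \<in> space (count_space C)"
      then obtain a b where i: "i = (a, b)" "(a, b) \<in> C" by (cases i) auto
      moreover have "a < b" "f b - f a \<le> r * (b - a)" using C(2) i(2) by auto
      ultimately show "?\<nu> (?I i) \<le> ennreal r * ?\<mu> (?I i)"
        using r by (simp add: nu ennreal_leI flip: ennreal_mult)
    qed
    also have "\<dots> = ennreal r * ?\<mu> (\<Union>(?I ` C))"
      using C by (simp add: sum nn_integral_cmult)
    also have "\<dots> \<le> ennreal r * ?\<mu> U"
      using C(2) U(1) by (intro mult_left_mono emeasure_mono) auto
    finally have up: "?\<nu> (\<Union>(?I ` C)) \<le> ennreal r * ?\<mu> U" .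
    \<comment> \<open>The second covering needs an open container. Passing to interiors loses only
      countably many endpoints.\<close>
    define V where "V = (\<Union>(l, r)\<in>C. {l<..<r})"
    have V: "open V" "V \<subseteq> (\<Union>(?I ` C))"
      unfolding V_def by (intro open_UN ballI) (auto simp: split_beta intro: less_imp_le)
    have "negligible ((\<Union>(l, r)\<in>C. {l, r}))"
      using C(1) by (intro countable_imp_null_set_lborel[THEN null_sets_completionI, folded negligible_iff_null_sets]) auto
    then have "negligible ((S - (\<Union>(l, r)\<in>C. {l..r})) \<union> (\<Union>(l, r)\<in>C. {l, r}))"
      using C(4) by simp
    then have SV: "negligible (S - V)"
      by (rule negligible_subset) (force simp: V_def)
    obtain D where D: "countable D" "\<forall>(a, b)\<in>D. a < b \<and> R * (b - a) \<le> f b - f a \<and> {a..b} \<subseteq> V"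
      "disjoint_family_on ?I D" "negligible ((S \<inter> V) - (\<Union>(l, r)\<in>D. {l..r}))"
      by (rule Vitali_covering_intervals[OF V(1) Int_lower2 large[OF IntD1]])
    have DC: "\<Union>(?I ` D) \<subseteq> \<Union>(?I ` C)" by (rule order_trans[OF _ V(2)]) (use D(2) in fast)
    have meas: "\<Union>(?I ` D) \<in> sets borel" "\<Union>(?I ` C) \<in> sets borel"
      using C(1) D(1) by auto
    have "ennreal R * ?\<mu> (\<Union>(?I ` D)) = (\<integral>\<^sup>+i. ennreal R * ?\<mu> (?I i) \<partial>count_space D)"
      using D by (simp add: sum nn_integral_cmult)
    also have "\<dots> \<le> (\<integral>\<^sup>+i. ?\<nu> (?I i) \<partial>count_space D)"
    proof (rule nn_integral_mono)
      fix i assume "i \<in> space (count_space D)"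
      then obtain a b where i: "i = (a, b)" "(a, b) \<in> D" by (cases i) auto
      moreover have "a < b" "R * (b - a) \<le> f b - f a" using D(2) i(2) by auto
      ultimately show "ennreal R * ?\<mu> (?I i) \<le> ?\<nu> (?I i)"
        using r by (simp add: nu ennreal_leI flip: ennreal_mult)
    qed
    also have "\<dots> = ?\<nu> (\<Union>(?I ` D))"
      using D by (simp add: sum)
    also have "\<dots> \<le> ?\<nu> (\<Union>(?I ` C))"
      using DC meas by (intro emeasure_mono) auto
    finally have RD: "ennreal R * ?\<mu> (\<Union>(?I ` D)) \<le> ennreal r * ?\<mu> U"
      using up by simp
    have "\<Union>(?I ` D) \<subseteq> U"
      using DC C(2) by fastforce
    then have D_lm: "\<Union>(?I ` D) \<in> lmeasurable"
      using U_lm meas by (intro fmeasurableI2[OF U_lm]) auto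
    have "S \<subseteq> \<Union>(?I ` D) \<union> ((S - V) \<union> ((S \<inter> V) - \<Union>(?I ` D)))"
      by auto
    moreover have N: "negligible ((S - V) \<union> ((S \<inter> V) - \<Union>(?I ` D)))"
      using SV D(4) by simp
    moreover have "measure lebesgue (\<Union>(?I ` D) \<union> ((S - V) \<union> ((S \<inter> V) - \<Union>(?I ` D)))) = measure lebesgue (\<Union>(?I ` D))"
      using N D_lm by (intro measure_Un_null_set) (auto simp: negligible_iff_null_sets fmeasurableD)
    ultimately have "e \<le> measure lebesgue (\<Union>(?I ` D))"
      using e_le D_lm by (metis fmeasurable.Un negligible_imp_measurable)
    moreover have "R * measure lebesgue (\<Union>(?I ` D)) \<le> r * measure lebesgue U"
    proof -
      have "?\<mu> (\<Union>(?I ` D)) = ennreal (measure lebesgue (\<Union>(?I ` D)))"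
        using D_lm meas by (intro fin) auto
      then show ?thesis
        using RD r unfolding lU by (simp flip: ennreal_mult)
    qed
    ultimately have "R * e \<le> r * measure lebesgue U"
      using r by (meson dual_order.trans less_imp_le mult_left_mono order_le_less_trans)
    also have "\<dots> \<le> r * (e + 2 * \<epsilon>)"
      using mU r by (intro mult_left_mono)
    finally show ?thesis .
  qed
  have "e = 0"
  proof (rule ccontr)
    assume "e \<noteq> 0"
    then have pos: "(R - r) * e > 0" using e0 r by simp
    \<comment> \<open>Chosen so that \<open>2 * (r + 1) * \<epsilon>\<close> equals
      \<open>(R - r) * e\<close>; the added 1 covers the case \<open>r = 0\<close>.\<close>
    define \<epsilon> where "\<epsilon> = (R - r) * e / (2 * (r + 1))"
    have "\<epsilon> > 0" using pos r by (simp add: \<epsilon>_def)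
    have "(R - r) * e \<le> 2 * r * \<epsilon>" using key[OF \<open>\<epsilon> > 0\<close>] by (simp add: algebra_simps)
    also have "\<dots> < 2 * (r + 1) * \<epsilon>" using \<open>\<epsilon> > 0\<close> by (simp add: algebra_simps)
    also have "\<dots> = (R - r) * e" using r by (simp add: \<epsilon>_def)
    finally show False by simp
  qed
  show ?thesis
    unfolding negligible_outer
  proof (intro allI impI)
    show "\<exists>T. S \<subseteq> T \<and> T \<in> lmeasurable \<and> measure lebesgue T < d" if "d > 0" for d
      using near[of d] that \<open>e = 0\<close> by auto
  qed
qed

text \<open>Where the difference quotient has no limit, two rationals separate its lower and upper
  limits. There are countably many such pairs and bounded windows, each giving a null set; the
  Lipschitz bound keeps the limit finite.\<close>

lemma negligible_not_differentiable_mono_lipschitz: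
  fixes f :: "real \<Rightarrow> real"
  assumes "mono f" and lip: "K-lipschitz_on UNIV f"
  shows "negligible {t. \<not> f differentiable (at t)}"
proof -
  define q where "q t s = (f s - f t) / (s - t)" for t s
  define E where "E p n = {t. (\<exists>\<^sub>F s in at t. q t s < of_rat (fst p)) \<and>
    (\<exists>\<^sub>F s in at t. of_rat (snd p) < q t s)} \<inter> {- real n..real n}" for p :: "rat \<times> rat" and n
  have f_le: "f s \<le> f t" if "s \<le> t" for s t
    using \<open>mono f\<close> that by (rule monoD)
  \<comment> \<open>At \<open>s = t\<close> division by zero makes the quotient 0, so this bound and
    the next hold without a side condition.\<close>
  have q0: "0 \<le> q t s" for t s
    unfolding q_def using f_le[of s t] f_le[of t s]
    by (cases "s \<le> t") (auto intro: divide_nonpos_nonpos)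
  have qK: "q t s \<le> K" for t s
  proof (cases "s = t")
    case True then show ?thesis using lip by (simp add: q_def lipschitz_on_nonneg)
  next
    case False
    have "\<bar>f s - f t\<bar> \<le> K * \<bar>s - t\<bar>"
      using lipschitz_onD[OF lip, of s t] by (simp add: dist_real_def)
    then have "\<bar>q t s\<bar> \<le> K" using False by (simp add: q_def field_simps)
    then show ?thesis by linarith
  qed
  have neg: "negligible (E p n)" if p: "0 \<le> fst p" "fst p < snd p" for p n
  proof (rule negligible_oscillating_quotients[OF \<open>mono f\<close>, of _ "of_rat (fst p)" "of_rat (snd p)"])
    show "continuous_on UNIV f" using lip by (rule lipschitz_on_continuous_on)
    show "bounded (E p n)" by (rule bounded_subset[of "{- real n..real n}"]) (auto simp: E_def)
    show "(0::real) \<le> of_rat (fst p)" "(of_rat (fst p)::real) < of_rat (snd p)"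
      using p by (auto simp: of_rat_less)
    \<comment> \<open>The quotient is symmetric, so a nearby \<open>s\<close> on either side of
      \<open>t\<close> gives an interval with endpoint \<open>t\<close>.\<close>
    have near: "\<exists>a b. a < b \<and> t \<in> {a..b} \<and> b - a < d \<and> P ((f b - f a) / (b - a))"
      if fr: "\<exists>\<^sub>F s in at t. P (q t s)" and "0 < d" for t d P
    proof -
      have "\<forall>\<^sub>F s in at t. dist s t < d \<and> s \<noteq> t"
        using \<open>0 < d\<close> by (auto simp: eventually_at)
      then obtain s where s: "P (q t s)" "dist s t < d" "s \<noteq> t"
        using frequently_ex[OF frequently_eventually_conj[OF fr]] by blast
      have "q t s = (f (max s t) - f (min s t)) / (max s t - min s t)"
        using s(3) by (auto simp: q_def max_def min_def field_simps)
      with s show ?thesis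
        by (intro exI[of _ "min s t"] exI[of _ "max s t"]) (auto simp: dist_real_def max_def min_def)
    qed
    fix t d :: real assume t: "t \<in> E p n" and d: "0 < d"
    obtain a b where "a < b" "t \<in> {a..b}" "b - a < d" "(f b - f a) / (b - a) < of_rat (fst p)"
      using near[where t = t and d = d and P = "\<lambda>x. x < of_rat (fst p)"] t d by (auto simp: E_def)
    then show "\<exists>a b. a < b \<and> t \<in> {a..b} \<and> b - a < d \<and> f b - f a \<le> of_rat (fst p) * (b - a)"
      by (intro exI[of _ a] exI[of _ b]) (auto simp: field_simps)
    obtain a b where "a < b" "t \<in> {a..b}" "b - a < d" "(f b - f a) / (b - a) > of_rat (snd p)"
      using near[where t = t and d = d and P = "\<lambda>x. x > of_rat (snd p)"] t d by (auto simp: E_def)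
    then show "\<exists>a b. a < b \<and> t \<in> {a..b} \<and> b - a < d \<and> of_rat (snd p) * (b - a) \<le> f b - f a"
      by (intro exI[of _ a] exI[of _ b]) (auto simp: field_simps)
  qed
  have "f differentiable (at t)" if t: "\<And>p n. 0 \<le> fst p \<Longrightarrow> fst p < snd p \<Longrightarrow> t \<notin> E p n" for t
  proof -
    let ?Q = "\<lambda>s. ereal (q t s)"
    have "Limsup (at t) ?Q \<le> Liminf (at t) ?Q"
    proof (rule ccontr)
      assume "\<not> ?thesis"
      then have "Liminf (at t) ?Q < Limsup (at t) ?Q" by simp
      then obtain p2 where p2: "Liminf (at t) ?Q < ereal (real_of_rat p2)" "ereal (real_of_rat p2) < Limsup (at t) ?Q"
        using ereal_dense3 by blast
      then obtain p1 where p1: "Liminf (at t) ?Q < ereal (real_of_rat p1)" "ereal (real_of_rat p1) < ereal (real_of_rat p2)"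
        using ereal_dense3 by blast
      have "0 \<le> Liminf (at t) ?Q"
        by (rule Liminf_bounded) (simp add: q0)
      then have "0 \<le> ereal (real_of_rat p1)"
        using p1(1) by (meson less_imp_le order_trans)
      then have "0 \<le> p1" by simp
      moreover have "p1 < p2" using p1(2) by (simp add: of_rat_less)
      moreover have "\<exists>\<^sub>F s in at t. q t s < of_rat p1"
      proof (rule ccontr)
        assume "\<not> ?thesis"
        then have "\<forall>\<^sub>F s in at t. ereal (of_rat p1) \<le> ?Q s"
          by (simp add: not_frequently not_less)
        from Liminf_bounded[OF this] p1(1) show False by simp
      qed
      moreover have "\<exists>\<^sub>F s in at t. of_rat p2 < q t s"
      proof (rule ccontr)
        assume "\<not> ?thesis"
        then have "\<forall>\<^sub>F s in at t. ?Q s \<le> ereal (of_rat p2)"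
          by (simp add: not_frequently not_less)
        from Limsup_bounded[OF this] p2(2) show False by simp
      qed
      moreover obtain n where "\<bar>t\<bar> \<le> real n" using real_arch_simple by blast
      ultimately have "t \<in> E (p1, p2) n" by (auto simp: E_def)
      then show False using t[of "(p1, p2)" n] \<open>0 \<le> p1\<close> \<open>p1 < p2\<close> by simp
    qed
    moreover have "Liminf (at t) ?Q \<le> Limsup (at t) ?Q"
      by (rule Liminf_le_Limsup) simp
    ultimately have lim: "(?Q \<longlongrightarrow> Limsup (at t) ?Q) (at t)"
      by (intro Liminf_eq_Limsup) auto
    have "0 \<le> Limsup (at t) ?Q"
      using lim by (rule tendsto_lowerbound) (auto simp: q0)
    moreover have "Limsup (at t) ?Q \<le> ereal K"
      using lim by (rule tendsto_upperbound) (auto simp: qK)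
    ultimately obtain D where "Limsup (at t) ?Q = ereal D"
      by (cases "Limsup (at t) ?Q") auto
    with lim have "(q t \<longlongrightarrow> D) (at t)" by simp
    then have "(f has_field_derivative D) (at t)"
      by (simp add: has_field_derivative_iff q_def[abs_def])
    then show ?thesis
      using real_differentiable_def by blast
  qed
  then have "{t. \<not> f differentiable (at t)} \<subseteq> \<Union>(range (\<lambda>(p, n). if 0 \<le> fst p \<and> fst p < snd p then E p n else {}))"
    by fastforce
  moreover have "negligible (\<Union>(range (\<lambda>(p, n). if 0 \<le> fst p \<and> fst p < snd p then E p n else {})))"
    using neg by (intro negligible_countable_Union) auto
  ultimately show ?thesis
    using negligible_subset by blast
qed

text \<open>The exceptional set has negligible image under the tilted function \<open>g\<close>, so some level between
  \<open>g a\<close> and \<open>g b\<close> is last attained at a point of differentiability.\<close>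

lemma lipschitz_nonincreasing_if_ae_derivative_nonpos:
  fixes f :: "real \<Rightarrow> real"
  assumes lip: "K-lipschitz_on {a..b} f" and "a \<le> b" "negligible N"
    and deriv: "\<And>t. t \<in> {a..b} - N \<Longrightarrow> \<exists>d\<le>0. (f has_real_derivative d) (at t within {a..b})"
  shows "f b \<le> f a"
proof (rule ccontr)
  assume "\<not> f b \<le> f a"
  with \<open>a \<le> b\<close> have ab: "f a < f b" "a < b" by (auto simp: le_less)
  \<comment> \<open>Half the mean slope: after subtracting it \<open>g\<close> still rises from
    \<open>a\<close> to \<open>b\<close>, while its derivatives outside \<open>N\<close> are at most
    \<open>- \<epsilon>\<close>.\<close>
  define \<epsilon> where "\<epsilon> = (f b - f a) / (2 * (b - a))"
  have "\<epsilon> > 0" using ab by (simp add: \<epsilon>_def)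
  define g where "g t = f t - \<epsilon> * (t - a)" for t
  have "g a < g b"
  proof -
    have "\<epsilon> * (b - a) = (f b - f a) / 2" using ab using ab by (simp add: \<epsilon>_def divide_simps)
    then show ?thesis using ab by (simp add: g_def field_simps)
  qed
  have g_cont: "continuous_on {a..b} g"
    unfolding g_def by (intro continuous_intros lipschitz_on_continuous_on[OF lip])
  have "negligible (g ` (N \<inter> {a..b}))"
  proof (rule negligible_locally_Lipschitz_image)
    show "negligible (N \<inter> {a..b})" using \<open>negligible N\<close> by (simp add: negligible_Int)
    fix s assume s: "s \<in> N \<inter> {a..b}"
    have "norm (g t - g s) \<le> (K + \<epsilon>) * norm (t - s)" if "t \<in> {a..b}" for t
    proof -
      have "\<bar>f t - f s\<bar> \<le> K * \<bar>t - s\<bar>"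
        using lipschitz_onD[OF lip that, of s] s by (simp add: dist_real_def)
      moreover have "g t - g s = (f t - f s) - \<epsilon> * (t - s)" by (simp add: g_def algebra_simps)
      moreover have "\<bar>\<epsilon> * (t - s)\<bar> = \<epsilon> * \<bar>t - s\<bar>" using \<open>\<epsilon> > 0\<close> by (simp add: abs_mult)
      ultimately show ?thesis by (simp add: algebra_simps)
    qed
    then show "\<exists>T B. open T \<and> s \<in> T \<and> (\<forall>t\<in>N \<inter> {a..b} \<inter> T. norm (g t - g s) \<le> B * norm (t - s))"
      by (intro exI[of _ UNIV] exI[of _ "K + \<epsilon>"]) auto
  qed simp
  moreover have "\<not> negligible {g a<..<g b}"
    using \<open>g a < g b\<close> by (intro open_not_negligible) auto
  ultimately have "\<not> {g a<..<g b} \<subseteq> g ` (N \<inter> {a..b})"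
    using negligible_subset by blast
  then obtain y where "y \<in> {g a<..<g b}" and yN: "y \<notin> g ` (N \<inter> {a..b})"
    by blast
  then have y: "g a < y" "y < g b" by auto
  \<comment> \<open>Its maximum \<tau> is the last time at level \<open>y\<close>. Beyond it
    \<open>g\<close> exceeds \<open>y\<close>, so the right-hand quotients at \<tau> are
    nonnegative, against a negative derivative.\<close>
  define Z where "Z = {t \<in> {a..b}. g t \<le> y}"
  have "Z = {a..b} \<inter> g -` {..y}" by (auto simp: Z_def)
  then have "closed Z"
    using continuous_closed_preimage[OF g_cont, of "{..y}"] by simp
  moreover have "bounded Z"
    by (rule bounded_subset[OF bounded_closed_interval[of a b]]) (auto simp: Z_def)
  ultimately have "compact Z"
    by (simp add: compact_eq_bounded_closed)
  moreover have "a \<in> Z" using y ab by (simp add: Z_def)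
  ultimately obtain \<tau> where \<tau>: "\<tau> \<in> Z" "\<And>t. t \<in> Z \<Longrightarrow> t \<le> \<tau>"
    using compact_attains_sup[of Z] by blast
  then have "a \<le> \<tau>" "\<tau> \<le> b" "g \<tau> \<le> y"
    by (simp_all add: Z_def)
  moreover have "\<tau> \<noteq> b" using \<open>g \<tau> \<le> y\<close> y(2) by auto
  ultimately have "\<tau> < b" by simp
  have after: "y < g t" if "\<tau> < t" "t \<le> b" for t
  proof (rule ccontr)
    assume "\<not> y < g t"
    then have "t \<in> Z" using that \<open>a \<le> \<tau>\<close> by (simp add: Z_def)
    then show False using \<tau>(2) that by fastforce
  qed
  have "g \<tau> = y"
  proof (rule ccontr)
    assume "g \<tau> \<noteq> y"
    then obtain t where "\<tau> \<le> t" "t \<le> b" "g t = y"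
      using IVT'[of g \<tau> y b] \<open>g \<tau> \<le> y\<close> y(2) \<open>\<tau> < b\<close> continuous_on_subset[OF g_cont, of "{\<tau>..b}"] \<open>a \<le> \<tau>\<close>
      by auto
    then show False using after[of t] \<open>g \<tau> \<noteq> y\<close> by (cases "t = \<tau>") auto
  qed
  then have "\<tau> \<in> {a..b} - N"
    using yN \<open>a \<le> \<tau>\<close> \<open>\<tau> < b\<close> by auto
  then obtain d where d: "d \<le> 0" "(f has_real_derivative d) (at \<tau> within {a..b})"
    using deriv by blast
  have "(g has_real_derivative d - \<epsilon>) (at \<tau> within {a..b})"
    unfolding g_def by (auto intro!: derivative_eq_intros d(2))
  then have "(g has_real_derivative d - \<epsilon>) (at \<tau> within {\<tau><..b})"
    by (rule DERIV_subset) (use \<open>a \<le> \<tau>\<close> in auto)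
  then have "((\<lambda>t. (g t - g \<tau>) / (t - \<tau>)) \<longlongrightarrow> d - \<epsilon>) (at \<tau> within {\<tau><..b})"
    by (simp add: has_field_derivative_iff)
  then have "0 \<le> d - \<epsilon>"
  proof (rule tendsto_lowerbound)
    show "\<forall>\<^sub>F t in at \<tau> within {\<tau><..b}. 0 \<le> (g t - g \<tau>) / (t - \<tau>)"
      unfolding eventually_at_filter using after \<open>g \<tau> = y\<close>
      by (intro always_eventually) (auto intro!: divide_nonneg_pos less_imp_le)
    show "at \<tau> within {\<tau><..b} \<noteq> bot"
      using \<open>\<tau> < b\<close> by (simp add: at_within_eq_bot_iff)
  qed
  then show False using d \<open>\<epsilon> > 0\<close> by simp
qed

section \<open>The penalized explicit scheme\<close>

definition combine :: "real ^ 'm \<Rightarrow> 'a::real_inner ^ 'm \<Rightarrow> 'a" where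
  "combine p v = (\<Sum>i\<in>UNIV. p $ i *\<^sub>R v $ i)"

text \<open>\<open>combine (violation v c x) v\<close> is the gradient at \<open>x\<close> of half
  the squared norm of this vector.\<close>

definition violation :: "'a::real_inner ^ 'm \<Rightarrow> real ^ 'm \<Rightarrow> 'a \<Rightarrow> real ^ 'm" where
  "violation v c x = (\<chi> i. max 0 (v $ i \<bullet> x - c $ i))"

lemma violation_nth: "violation v c x $ i = max 0 (v $ i \<bullet> x - c $ i)"
  by (simp add: violation_def)

lemma norm_combine_le:
  fixes v :: "'a::real_inner ^ 'm"
  shows "norm (combine p v) \<le> real CARD('m) * norm p * norm v"
proof -
  have "norm (combine p v) \<le> (\<Sum>i\<in>(UNIV::'m set). norm p * norm v)"
    unfolding combine_def
  proof (rule order_trans[OF norm_sum sum_mono])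
    fix i
    have "\<bar>p $ i\<bar> \<le> norm p" using Finite_Cartesian_Product.norm_nth_le[of p i] by simp
    then show "norm (p $ i *\<^sub>R v $ i) \<le> norm p * norm v"
      using Finite_Cartesian_Product.norm_nth_le[of v i] by (simp add: mult_mono)
  qed
  then show ?thesis by simp
qed

text \<open>Supplies both the algebra of \<open>combine\<close> and the continuity that carries the
  multipliers through the limit.\<close>

lemma bounded_bilinear_combine:
  "bounded_bilinear (combine :: real ^ 'm \<Rightarrow> 'a::real_inner ^ 'm \<Rightarrow> 'a)"
proof
  show "\<exists>K. \<forall>p v. norm (combine p (v :: 'a ^ 'm)) \<le> norm p * norm v * K"
    by (rule exI[of _ "real CARD('m)"]) (metis norm_combine_le mult.commute mult.assoc)
qed (simp_all add: combine_def scaleR_add_left scaleR_add_right sum.distrib scaleR_sum_right mult.commute)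

interpretation combine: bounded_bilinear combine
  by (rule bounded_bilinear_combine)

lemma inner_combine: "combine p v \<bullet> y = (\<Sum>i\<in>UNIV. p $ i * (v $ i \<bullet> y))"
  by (simp add: combine_def inner_sum_left)

lemma power2_norm_vec: "(norm (p :: real ^ 'm))\<^sup>2 = (\<Sum>i\<in>UNIV. (p $ i)\<^sup>2)"
  unfolding power2_norm_eq_inner inner_vec_def by (simp add: power2_eq_square)

text \<open>The positive part is 1-Lipschitz; the factor \<open>CARD('m)\<close> comes from bounding
  the Euclidean norm by the sum of the coordinates.\<close>

lemma norm_violation_diff_le:
  fixes v w :: "'a::real_inner ^ 'm"
  shows "norm (violation v c x - violation w d x) \<le> real CARD('m) * (norm (v - w) * norm x + norm (c - d))"
proof -
  have "\<bar>(violation v c x - violation w d x) $ i\<bar> \<le> norm (v - w) * norm x + norm (c - d)" for i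
  proof -
    have "\<bar>(violation v c x - violation w d x) $ i\<bar> \<le> \<bar>(v - w) $ i \<bullet> x\<bar> + \<bar>(c - d) $ i\<bar>"
      by (auto simp: violation_nth inner_diff_left max_def)
    also have "\<dots> \<le> norm ((v - w) $ i) * norm x + norm (c - d)"
      using Cauchy_Schwarz_ineq2[of "(v - w) $ i" x] Finite_Cartesian_Product.norm_nth_le[of "c - d" i] by simp
    also have "\<dots> \<le> norm (v - w) * norm x + norm (c - d)"
      using Finite_Cartesian_Product.norm_nth_le[of "v - w" i] by (simp add: mult_right_mono)
    finally show ?thesis .
  qed
  then have "(\<Sum>i\<in>(UNIV::'m set). \<bar>(violation v c x - violation w d x) $ i\<bar>)
      \<le> (\<Sum>i\<in>(UNIV::'m set). norm (v - w) * norm x + norm (c - d))"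
    by (rule sum_mono)
  then show ?thesis
    using norm_le_l1_cart[of "violation v c x - violation w d x"] by simp
qed

text \<open>Only violated constraints contribute, and for those
  \<open>v $ i \<bullet> (x - z)\<close> is at least the violation plus \<delta>.\<close>

lemma combine_violation_inner_ge:
  fixes v :: "'a::real_inner ^ 'm"
  assumes "\<And>i. v $ i \<bullet> z \<le> c $ i - \<delta>" "0 \<le> \<delta>"
  shows "combine (violation v c x) v \<bullet> (x - z) \<ge> (norm (violation v c x))\<^sup>2 + \<delta> * norm (violation v c x)"
proof -
  let ?p = "violation v c x"
  have "\<delta> * norm ?p \<le> \<delta> * (\<Sum>i\<in>UNIV. \<bar>?p $ i\<bar>)"
    using norm_le_l1_cart[of ?p] \<open>0 \<le> \<delta>\<close> by (intro mult_left_mono)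
  then have "(norm ?p)\<^sup>2 + \<delta> * norm ?p \<le> (\<Sum>i\<in>UNIV. (?p $ i)\<^sup>2 + \<delta> * \<bar>?p $ i\<bar>)"
    by (simp add: power2_norm_vec sum.distrib sum_distrib_left)
  also have "\<dots> \<le> (\<Sum>i\<in>UNIV. ?p $ i * (v $ i \<bullet> (x - z)))"
  proof (rule sum_mono)
    fix i
    show "(?p $ i)\<^sup>2 + \<delta> * \<bar>?p $ i\<bar> \<le> ?p $ i * (v $ i \<bullet> (x - z))"
    proof (cases "v $ i \<bullet> x - c $ i > 0")
      case True
      then have "?p $ i * (?p $ i + \<delta>) \<le> ?p $ i * (v $ i \<bullet> (x - z))"
        using assms(1)[of i] by (intro mult_left_mono) (simp_all add: violation_nth inner_diff_right)
      then show ?thesis using True by (simp add: violation_nth power2_eq_square algebra_simps)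
    qed (simp add: violation_nth)
  qed
  finally show ?thesis by (simp add: inner_combine)
qed

text \<open>One explicit gradient step on the squared penalty. The Slater point bounds the gradient below by
  a multiple of the violation, hence the contraction by a factor independent of \<open>x\<close>.\<close>

lemma violation_step_contracts:
  fixes v :: "'a::real_inner ^ 'm"
  assumes slater: "\<And>i. v $ i \<bullet> z \<le> c $ i - \<delta>" and \<delta>: "0 < \<delta>" and M: "norm (x - z) \<le> M" "0 < M"
    and U: "norm v \<le> U" and \<alpha>: "0 < \<alpha>" "\<alpha> * (real CARD('m) * U)\<^sup>2 \<le> 1" "\<alpha> * \<delta>\<^sup>2 \<le> M\<^sup>2"
  defines "y \<equiv> x - \<alpha> *\<^sub>R combine (violation v c x) v"
  shows "norm (y - z) \<le> norm (x - z)"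
    and "norm (violation v c y) \<le> (1 - \<alpha> * \<delta>\<^sup>2 / (2 * M\<^sup>2)) * norm (violation v c x)"
proof -
  define p where "p = violation v c x"
  define g where "g = combine p v"
  define W where "W = real CARD('m) * U"
  have "U \<ge> 0" using U norm_ge_zero order_trans by blast
  have "W \<ge> 0" using \<open>U \<ge> 0\<close> by (simp add: W_def)
  have "1 \<le> real CARD('m)" by (simp add: Suc_leI)
  have gp: "norm g \<le> W * norm p"
  proof -
    have "norm g \<le> real CARD('m) * norm p * norm v" unfolding g_def by (rule norm_combine_le)
    also have "\<dots> \<le> real CARD('m) * norm p * U" using U by (intro mult_left_mono) auto
    finally show ?thesis by (simp add: W_def mult_ac)
  qed
  have ge: "g \<bullet> (x - z) \<ge> (norm p)\<^sup>2 + \<delta> * norm p"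
    unfolding g_def p_def using slater \<delta> by (intro combine_violation_inner_ge) auto
  \<comment> \<open>The first upper bound on \<alpha> lets the linear decrease absorb the quadratic
    term, so the distance to \<open>z\<close> cannot grow.\<close>
  have "\<alpha> * (norm g)\<^sup>2 \<le> \<alpha> * (W * norm p)\<^sup>2"
    using gp \<alpha>(1) by (intro mult_left_mono power_mono) auto
  also have "\<dots> = (\<alpha> * W\<^sup>2) * (norm p)\<^sup>2" by (simp add: power_mult_distrib)
  also have "\<dots> \<le> 1 * (norm p)\<^sup>2" using \<alpha>(2) by (intro mult_right_mono) (auto simp: W_def)
  also have "\<dots> \<le> g \<bullet> (x - z)" using ge \<delta> by (smt (verit, ccfv_threshold) mult_nonneg_nonneg norm_ge_zero)
  finally have "\<alpha> * (\<alpha> * (norm g)\<^sup>2) \<le> \<alpha> * (g \<bullet> (x - z))"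
    using \<alpha>(1) by (intro mult_left_mono) auto
  moreover have "(norm (y - z))\<^sup>2 = (norm (x - z))\<^sup>2 - 2 * \<alpha> * (g \<bullet> (x - z)) + \<alpha> * (\<alpha> * (norm g)\<^sup>2)"
    unfolding y_def p_def[symmetric] g_def[symmetric]
    by (simp add: power2_norm_eq_inner inner_diff_left inner_diff_right inner_commute algebra_simps)
  moreover have "0 \<le> \<alpha> * (g \<bullet> (x - z))"
    using ge \<delta> \<alpha>(1) by (intro mult_nonneg_nonneg) (smt (verit) mult_nonneg_nonneg norm_ge_zero zero_le_power2)+
  ultimately have "(norm (y - z))\<^sup>2 \<le> (norm (x - z))\<^sup>2" by linarith
  then show "norm (y - z) \<le> norm (x - z)" by (simp add: power2_le_iff_abs_le)

  define q where "q = violation v c y"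
  \<comment> \<open>Cauchy-Schwarz turns the Slater inequality into the gradient bound
    \<open>norm g \<ge> \<delta> * norm p / M\<close>.\<close>
  have "\<delta> * norm p \<le> g \<bullet> (x - z)" using ge by (smt (verit) zero_le_power2)
  also have "\<dots> \<le> norm g * norm (x - z)" by (rule norm_cauchy_schwarz)
  also have "\<dots> \<le> norm g * M" using M by (intro mult_left_mono) auto
  finally have "(\<delta> * norm p)\<^sup>2 \<le> (norm g * M)\<^sup>2" using \<delta> by (intro power_mono) auto
  then have gp2: "\<delta>\<^sup>2 / M\<^sup>2 * (norm p)\<^sup>2 \<le> (norm g)\<^sup>2" using M by (simp add: power_mult_distrib field_simps)
  have "(q $ i)\<^sup>2 \<le> (p $ i)\<^sup>2 - 2 * \<alpha> * (p $ i * (v $ i \<bullet> g)) + \<alpha>\<^sup>2 * (norm v * norm g)\<^sup>2" for i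
  proof -
    let ?d = "\<alpha> * (v $ i \<bullet> g)" and ?a = "v $ i \<bullet> x - c $ i"
    \<comment> \<open>A satisfied constraint becomes violated by at most
      \<open>\<bar>?d\<bar>\<close>, so the expansion of the square remains an upper bound for
      it.\<close>
    have "(max 0 (?a - ?d))\<^sup>2 \<le> (max 0 ?a)\<^sup>2 - 2 * max 0 ?a * ?d + ?d\<^sup>2"
    proof (cases "?a > 0")
      case True
      have "(max 0 (?a - ?d))\<^sup>2 \<le> (?a - ?d)\<^sup>2" by (simp add: max_def)
      then show ?thesis using True by (simp add: power2_diff)
    next
      case False
      then have "max 0 (?a - ?d) \<le> \<bar>?d\<bar>" by (auto simp: max_def)
      then have "(max 0 (?a - ?d))\<^sup>2 \<le> \<bar>?d\<bar>\<^sup>2" by (intro power_mono) auto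
      moreover have "max 0 ?a = 0" using False by simp
      ultimately show ?thesis by simp
    qed
    moreover have "q $ i = max 0 (?a - ?d)"
      unfolding q_def y_def p_def[symmetric] g_def[symmetric] by (simp add: violation_nth inner_diff_right algebra_simps)
    moreover have "?d\<^sup>2 \<le> \<alpha>\<^sup>2 * (norm v * norm g)\<^sup>2"
    proof -
      have "\<bar>v $ i \<bullet> g\<bar> \<le> norm (v $ i) * norm g" by (rule Cauchy_Schwarz_ineq2)
      also have "\<dots> \<le> norm v * norm g" using Finite_Cartesian_Product.norm_nth_le[of v i] by (intro mult_right_mono) auto
      finally have "\<bar>v $ i \<bullet> g\<bar>\<^sup>2 \<le> (norm v * norm g)\<^sup>2" by (intro power_mono) auto
      then show ?thesis by (simp add: power_mult_distrib mult_left_mono)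
    qed
    ultimately show ?thesis by (simp add: p_def violation_nth mult_ac)
  qed
  then have "(norm q)\<^sup>2 \<le> (\<Sum>i\<in>UNIV. (p $ i)\<^sup>2 - 2 * \<alpha> * (p $ i * (v $ i \<bullet> g)) + \<alpha>\<^sup>2 * (norm v * norm g)\<^sup>2)"
    unfolding power2_norm_vec by (rule sum_mono)
  also have "\<dots> = (norm p)\<^sup>2 - 2 * \<alpha> * (norm g)\<^sup>2 + real CARD('m) * (\<alpha>\<^sup>2 * (norm v * norm g)\<^sup>2)"
  proof -
    have "(\<Sum>i\<in>UNIV. p $ i * (v $ i \<bullet> g)) = (norm g)\<^sup>2"
      using inner_combine[of p v g] by (simp add: g_def power2_norm_eq_inner)
    then show ?thesis by (simp add: sum.distrib sum_subtractf power2_norm_vec[of p] flip: sum_distrib_left)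
  qed
  also have "\<dots> \<le> (norm p)\<^sup>2 - 2 * \<alpha> * (norm g)\<^sup>2 + \<alpha> * (norm g)\<^sup>2"
  proof -
    have "real CARD('m) * (norm v)\<^sup>2 \<le> (real CARD('m))\<^sup>2 * U\<^sup>2"
      using U \<open>1 \<le> real CARD('m)\<close> by (intro mult_mono power_mono) (auto simp: self_le_power)
    then have "\<alpha> * (real CARD('m) * (norm v)\<^sup>2) \<le> \<alpha> * (real CARD('m) * U)\<^sup>2"
      using \<alpha>(1) by (simp add: power_mult_distrib)
    then have "\<alpha> * (real CARD('m) * (norm v)\<^sup>2) \<le> 1" using \<alpha>(2) by linarith
    then have "(\<alpha> * (real CARD('m) * (norm v)\<^sup>2)) * (\<alpha> * (norm g)\<^sup>2) \<le> 1 * (\<alpha> * (norm g)\<^sup>2)"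
      using \<alpha>(1) by (intro mult_right_mono) auto
    then show ?thesis by (simp add: power_mult_distrib power2_eq_square mult_ac)
  qed
  also have "\<dots> = (norm p)\<^sup>2 - \<alpha> * (norm g)\<^sup>2" by simp
  also have "\<dots> \<le> (norm p)\<^sup>2 - \<alpha> * (\<delta>\<^sup>2 / M\<^sup>2 * (norm p)\<^sup>2)"
    using mult_left_mono[OF gp2, of \<alpha>] \<alpha>(1) by simp
  also have "\<dots> \<le> ((1 - \<alpha> * \<delta>\<^sup>2 / (2 * M\<^sup>2)) * norm p)\<^sup>2"
  proof -
    \<comment> \<open>Bernoulli's inequality: halving the rate bounds the factor by a square, so
      that a root can be taken.\<close>
    have "1 - \<alpha> * (\<delta>\<^sup>2 / M\<^sup>2) \<le> (1 - \<alpha> * \<delta>\<^sup>2 / (2 * M\<^sup>2))\<^sup>2"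
      by (simp add: power2_diff)
    then have "(1 - \<alpha> * (\<delta>\<^sup>2 / M\<^sup>2)) * (norm p)\<^sup>2 \<le> (1 - \<alpha> * \<delta>\<^sup>2 / (2 * M\<^sup>2))\<^sup>2 * (norm p)\<^sup>2"
      by (rule mult_right_mono) auto
    then show ?thesis unfolding power_mult_distrib by (simp only: left_diff_distrib mult_1 mult.assoc)
  qed
  finally have "(norm q)\<^sup>2 \<le> ((1 - \<alpha> * \<delta>\<^sup>2 / (2 * M\<^sup>2)) * norm p)\<^sup>2" .
  moreover have "0 \<le> (1 - \<alpha> * \<delta>\<^sup>2 / (2 * M\<^sup>2)) * norm p"
  proof (rule mult_nonneg_nonneg)
    have "\<alpha> * \<delta>\<^sup>2 / (2 * M\<^sup>2) \<le> 1"
      using \<alpha>(3) M by (simp add: divide_le_eq) (smt (verit) zero_le_power2)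
    then show "0 \<le> 1 - \<alpha> * \<delta>\<^sup>2 / (2 * M\<^sup>2)" by simp
  qed simp
  ultimately have "norm q \<le> (1 - \<alpha> * \<delta>\<^sup>2 / (2 * M\<^sup>2)) * norm p"
    by (rule power2_le_imp_le)
  then show "norm (violation v c y) \<le> (1 - \<alpha> * \<delta>\<^sup>2 / (2 * M\<^sup>2)) * norm (violation v c x)"
    unfolding q_def p_def .
qed

text \<open>The bounds are global in time, so grid points need no range checks; a local problem
  takes this form after clamping time. The upper bounds on \<alpha> keep the distance to
  \<open>z\<close> from growing and the contraction factor nonnegative.\<close>

locale penalized_scheme =
  fixes u :: "real \<Rightarrow> 'a::{real_inner, complete_space} ^ 'm" and b :: "real \<Rightarrow> real ^ 'm"
    and z x0 :: 'a and t0 t1 L U \<delta> M \<alpha> :: real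
  assumes u_lip: "\<And>s t. norm (u t - u s) \<le> L * \<bar>t - s\<bar>"
    and b_lip: "\<And>s t. norm (b t - b s) \<le> L * \<bar>t - s\<bar>"
    and u_bound: "\<And>t. norm (u t) \<le> U"
    and slater: "\<And>t i. u t $ i \<bullet> z \<le> b t $ i - \<delta>"
    and \<delta>_pos: "0 < \<delta>" and L_nonneg: "0 \<le> L" and M_pos: "0 < M" and x0_near: "norm (x0 - z) \<le> M"
    and \<alpha>: "0 < \<alpha>" "\<alpha> * (real CARD('m) * U)\<^sup>2 \<le> 1" "\<alpha> * \<delta>\<^sup>2 \<le> M\<^sup>2"
    and x0_feasible: "\<And>i. u t0 $ i \<bullet> x0 \<le> b t0 $ i"
    and t01: "t0 \<le> t1"
begin

section \<open>Grid, iterates and constants\<close>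

definition "node h k = t0 + real k * h"

primrec X :: "real \<Rightarrow> nat \<Rightarrow> 'a" where
  "X h 0 = x0"
| "X h (Suc k) = X h k - \<alpha> *\<^sub>R combine (violation (u (node h k)) (b (node h k)) (X h k)) (u (node h k))"

definition "p h k = violation (u (node h k)) (b (node h k)) (X h k)"
text \<open>The grid is frozen after \<open>t1\<close>, and \<^const>\<open>nat\<close> freezes it before \<open>t0\<close>, so that
  the step functions below are defined on the whole line and uniformly bounded.\<close>

definition "idx h t = nat \<lfloor>(min t t1 - t0) / h\<rfloor>"
definition "x_step h t = X h (idx h t)"
definition "\<Lambda>_step h t = \<alpha> *\<^sub>R (\<Sum>j<idx h t. p h j)"

text \<open>\<open>N\<close> bounds the iterates; \<open>Q\<close> is a Lipschitz constant in time of the violation and \<open>\<theta>\<close> its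
  contraction rate per step; \<open>B\<close> and \<open>W * B\<close> bound the rates of the multipliers and of the iterates.\<close>

definition "N = norm z + M"
definition "W = real CARD('m) * U"
definition "Q = real CARD('m) * (L * N + L)"
definition "\<theta> = \<alpha> * \<delta>\<^sup>2 / (2 * M\<^sup>2)"
definition "B = \<alpha> * (Q / \<theta>)"
text \<open>\<open>G\<close> is the constant of the quadratic remainder, \<open>H\<close> the slack
  per unit of time in complementarity, \<open>F\<close> the feasibility error per unit of mesh
  size.\<close>

definition "G = real CARD('m) * L * B"
definition "H = L * N + U * (W * B) + L"
definition "F = Q / \<theta> + L * N + L"

lemma X_Suc: "X h (Suc k) = X h k - \<alpha> *\<^sub>R combine (p h k) (u (node h k))"
  by (simp add: p_def)

lemma const_bounds: "0 < \<theta>" "\<theta> \<le> 1" "0 \<le> U" "0 \<le> N" "0 \<le> Q" "0 \<le> W" "0 \<le> B" "0 \<le> G" "0 \<le> H" "0 \<le> F"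
proof -
  show \<theta>: "0 < \<theta>" using \<alpha> \<delta>_pos M_pos by (simp add: \<theta>_def)
  have "\<alpha> * \<delta>\<^sup>2 \<le> 2 * M\<^sup>2" using \<alpha>(3) by (smt (verit) zero_le_power2)
  then show "\<theta> \<le> 1" using M_pos by (simp add: \<theta>_def)
  show U: "0 \<le> U" using u_bound norm_ge_zero order_trans by blast
  show N: "0 \<le> N" using M_pos by (simp add: N_def)
  show Q: "0 \<le> Q" using N L_nonneg by (simp add: Q_def)
  show W: "0 \<le> W" using U by (simp add: W_def)
  show B: "0 \<le> B" using Q \<alpha>(1) \<theta> by (simp add: B_def)
  show "0 \<le> G" "0 \<le> H" "0 \<le> F" using B U W N L_nonneg Q \<theta> by (simp_all add: G_def H_def F_def)
qed

lemma X_near: "norm (X h k - z) \<le> M"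
proof (induction k)
  case 0
  then show ?case using x0_near by simp
next
  case (Suc k)
  have "norm (X h (Suc k) - z) \<le> norm (X h k - z)"
    unfolding X.simps
    by (rule violation_step_contracts(1)[OF slater \<delta>_pos Suc M_pos u_bound \<alpha>])
  with Suc show ?case by linarith
qed

lemma X_bound: "norm (X h k) \<le> N"
  using X_near[of h k] norm_triangle_ineq2[of "X h k" z] by (simp add: N_def)

text \<open>\<open>Q * h / \<theta>\<close> is the fixed point of
  \<open>a \<mapsto> (1 - \<theta>) * a + Q * h\<close>: a step contracts the violation by
  \<open>1 - \<theta>\<close>, and moving to the next node adds at most \<open>Q * h\<close>.
  Feasibility of \<open>x0\<close> starts the induction at zero.\<close>

lemma p_bound:
  assumes "0 < h"
  shows "norm (p h k) \<le> Q * h / \<theta>"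
proof (induction k)
  case 0
  have "p h 0 = 0"
    using x0_feasible by (simp add: p_def violation_def vec_eq_iff node_def)
  then show ?case using const_bounds assms by simp
next
  case (Suc k)
  let ?v = "violation (u (node h k)) (b (node h k)) (X h (Suc k))"
  have "norm ?v \<le> (1 - \<theta>) * norm (p h k)"
    unfolding X.simps \<theta>_def p_def
    by (rule violation_step_contracts(2)[OF slater \<delta>_pos X_near M_pos u_bound \<alpha>])
  also have "\<dots> \<le> (1 - \<theta>) * (Q * h / \<theta>)"
    using Suc const_bounds by (intro mult_left_mono) auto
  also have "\<dots> = Q * h / \<theta> - Q * h"
    using const_bounds by (simp add: field_simps)
  finally have "norm ?v \<le> Q * h / \<theta> - Q * h" .
  moreover have "norm (p h (Suc k) - ?v) \<le> Q * h"
  proof -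
    have nd: "\<bar>node h (Suc k) - node h k\<bar> = h" using assms by (simp add: node_def algebra_simps)
    have "norm (p h (Suc k) - ?v) \<le> real CARD('m) * (norm (u (node h (Suc k)) - u (node h k)) * norm (X h (Suc k))
        + norm (b (node h (Suc k)) - b (node h k)))"
      unfolding p_def by (rule norm_violation_diff_le)
    also have "\<dots> \<le> real CARD('m) * ((L * h) * N + L * h)"
      using u_lip[of "node h (Suc k)" "node h k"] b_lip[of "node h (Suc k)" "node h k"] X_bound[of h "Suc k"]
        L_nonneg assms unfolding nd
      by (intro mult_left_mono add_mono mult_mono) auto
    finally show ?thesis by (simp add: Q_def algebra_simps)
  qed
  ultimately show ?case
    using norm_triangle_sub[of "p h (Suc k)" ?v] by linarith
qed

lemma \<alpha>p_bound: "0 < h \<Longrightarrow> norm (\<alpha> *\<^sub>R p h k) \<le> B * h"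
  using mult_left_mono[OF p_bound, of h \<alpha> k] \<alpha>(1) by (simp add: B_def)

lemma X_diff: "m \<le> n \<Longrightarrow> X h n - X h m = - (\<Sum>j=m..<n. combine (\<alpha> *\<^sub>R p h j) (u (node h j)))"
  by (induction n rule: dec_induct) (simp_all add: X_Suc combine.scaleR_left del: X.simps(2))

lemma X_diff_le:
  assumes "0 < h" "m \<le> n"
  shows "norm (X h n - X h m) \<le> real (n - m) * h * (W * B)"
proof -
  have "norm (combine (\<alpha> *\<^sub>R p h j) (u (node h j))) \<le> h * (W * B)" for j
  proof -
    have "norm (combine (\<alpha> *\<^sub>R p h j) (u (node h j))) \<le> real CARD('m) * norm (\<alpha> *\<^sub>R p h j) * norm (u (node h j))"
      by (rule norm_combine_le)
    also have "\<dots> \<le> real CARD('m) * (B * h) * U"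
      using \<alpha>p_bound[of h j] u_bound[of "node h j"] assms const_bounds by (intro mult_mono) auto
    finally show ?thesis by (simp add: W_def mult_ac)
  qed
  then have "norm (\<Sum>j=m..<n. combine (\<alpha> *\<^sub>R p h j) (u (node h j))) \<le> (\<Sum>j=m..<n. h * (W * B))"
    by (rule sum_norm_le)
  then show ?thesis using X_diff[OF assms(2), of h] by (simp add: mult_ac)
qed

lemma \<Lambda>_diff:
  "idx h s \<le> idx h t \<Longrightarrow> \<Lambda>_step h t - \<Lambda>_step h s = (\<Sum>j=idx h s..<idx h t. \<alpha> *\<^sub>R p h j)"
  by (simp add: \<Lambda>_step_def scaleR_sum_right sum_diff_nat_ivl lessThan_atLeast0)

section \<open>Estimates between two times, uniform in the mesh size\<close>

context
  fixes h s t :: real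
  assumes h: "0 < h" and st: "s \<le> t"
begin

lemma idx_mono: "idx h s \<le> idx h t"
  unfolding idx_def using h st by (intro nat_mono floor_mono divide_right_mono) auto

text \<open>The floor in \<open>idx\<close> rounds down, so the first node counted may precede
  \<open>s\<close> by up to \<open>h\<close>. This rounding is why \<open>t - s + h\<close> replaces
  \<open>t - s\<close> below.\<close>

lemma node_bounds:
  assumes "idx h s \<le> j" "j < idx h t"
  shows "node h j \<le> t" "s \<le> node h j + h"
proof -
  have "real j + 1 \<le> (min t t1 - t0) / h"
    using assms(2) by (simp add: idx_def zless_nat_eq_int_zless) linarith
  then have "real j * h + h \<le> min t t1 - t0" using h by (simp add: field_simps)
  then have j: "node h j + h \<le> min t t1" unfolding node_def by linarith
  then show "node h j \<le> t" using h by simp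
  have "(min s t1 - t0) / h < real (idx h s) + 1" unfolding idx_def by linarith
  then have "(min s t1 - t0) / h < real j + 1" using assms(1) by linarith
  then have "min s t1 < node h j + h" using h by (simp add: field_simps node_def)
  then show "s \<le> node h j + h" using j by linarith
qed

lemma node_near:
  assumes "idx h s \<le> j" "j < idx h t"
  shows "\<bar>node h j - s\<bar> \<le> t - s + h"
  using node_bounds[OF assms] h st by linarith

lemma idx_diff: "real (idx h t - idx h s) * h \<le> t - s + h"
proof (cases "idx h t = 0")
  case True
  then show ?thesis using h st by simp
next
  case False
  then have "real (idx h t) \<le> (min t t1 - t0) / h" unfolding idx_def by linarith
  moreover have "(min s t1 - t0) / h < real (idx h s) + 1" unfolding idx_def by linarith
  ultimately have "real (idx h t) * h \<le> min t t1 - t0" "min s t1 - t0 < real (idx h s) * h + h"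
    using h by (simp_all add: field_simps)
  then have "real (idx h t) * h - real (idx h s) * h \<le> t - s + h" using st by linarith
  then show ?thesis using idx_mono by (simp add: of_nat_diff left_diff_distrib)
qed

lemma \<Lambda>_step_mono: "\<Lambda>_step h s $ i \<le> \<Lambda>_step h t $ i"
proof -
  have "0 \<le> (\<Lambda>_step h t - \<Lambda>_step h s) $ i"
    unfolding \<Lambda>_diff[OF idx_mono] using \<alpha>(1) by (auto intro!: sum_nonneg simp: p_def violation_nth)
  then show ?thesis by simp
qed

lemma sum_\<alpha>p_le: "(\<Sum>j=idx h s..<idx h t. norm (\<alpha> *\<^sub>R p h j)) \<le> B * (t - s + h)"
proof -
  have "(\<Sum>j=idx h s..<idx h t. norm (\<alpha> *\<^sub>R p h j)) \<le> (\<Sum>j=idx h s..<idx h t. B * h)"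
    using \<alpha>p_bound[OF h] by (rule sum_mono)
  also have "\<dots> = B * (real (idx h t - idx h s) * h)" by simp
  also have "\<dots> \<le> B * (t - s + h)" using idx_diff const_bounds by (intro mult_left_mono)
  finally show ?thesis .
qed

lemma \<Lambda>_step_lip: "norm (\<Lambda>_step h t - \<Lambda>_step h s) \<le> B * (t - s + h)"
  unfolding \<Lambda>_diff[OF idx_mono] by (rule order_trans[OF norm_sum sum_\<alpha>p_le])

lemma x_step_lip: "norm (x_step h t - x_step h s) \<le> W * B * (t - s + h)"
proof -
  have "norm (x_step h t - x_step h s) \<le> real (idx h t - idx h s) * h * (W * B)"
    unfolding x_step_def by (rule X_diff_le[OF h idx_mono])
  also have "\<dots> \<le> (t - s + h) * (W * B)" using idx_diff const_bounds by (intro mult_right_mono) auto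
  finally show ?thesis by (simp add: mult_ac)
qed

text \<open>The quadratic remainder is what turns differentiability of the scalar multipliers into
  differentiability of the trajectory.\<close>

lemma x_step_expansion:
  "norm (x_step h t - x_step h s + combine (\<Lambda>_step h t - \<Lambda>_step h s) (u s)) \<le> G * (t - s + h)\<^sup>2"
proof -
  let ?J = "{idx h s..<idx h t}"
  \<comment> \<open>Both increments sum over the same indices, so only the replacement of
    \<open>u (node h j)\<close> by \<open>u s\<close> remains. Its cost and the total multiplier are
    each of order \<open>t - s + h\<close>, whence the square.\<close>
  have "x_step h t - x_step h s + combine (\<Lambda>_step h t - \<Lambda>_step h s) (u s)
      = - (\<Sum>j\<in>?J. combine (\<alpha> *\<^sub>R p h j) (u (node h j) - u s))"
    unfolding x_step_def X_diff[OF idx_mono] \<Lambda>_diff[OF idx_mono]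
    by (simp add: combine.sum_left combine.diff_right sum_subtractf)
  also have "norm \<dots> \<le> (\<Sum>j\<in>?J. real CARD('m) * L * (t - s + h) * norm (\<alpha> *\<^sub>R p h j))"
    unfolding norm_minus_cancel
  proof (rule sum_norm_le)
    fix j assume j: "j \<in> ?J"
    have "norm (combine (\<alpha> *\<^sub>R p h j) (u (node h j) - u s)) \<le> real CARD('m) * norm (\<alpha> *\<^sub>R p h j) * norm (u (node h j) - u s)"
      by (rule norm_combine_le)
    also have "\<dots> \<le> real CARD('m) * norm (\<alpha> *\<^sub>R p h j) * (L * (t - s + h))"
      using order_trans[OF u_lip mult_left_mono[OF node_near L_nonneg]] j by (intro mult_left_mono) auto
    finally show "norm (combine (\<alpha> *\<^sub>R p h j) (u (node h j) - u s))
        \<le> real CARD('m) * L * (t - s + h) * norm (\<alpha> *\<^sub>R p h j)"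
      by (simp add: mult_ac)
  qed
  also have "\<dots> = real CARD('m) * L * (t - s + h) * (\<Sum>j\<in>?J. norm (\<alpha> *\<^sub>R p h j))"
    by (simp only: sum_distrib_left)
  also have "\<dots> \<le> real CARD('m) * L * (t - s + h) * (B * (t - s + h))"
    using sum_\<alpha>p_le L_nonneg h st by (intro mult_left_mono) auto
  finally show ?thesis by (simp add: G_def power2_eq_square mult_ac)
qed

text \<open>Complementarity in a form that is closed under pointwise limits.\<close>

lemma step_complementarity:
  "0 \<le> (\<Lambda>_step h t $ i - \<Lambda>_step h s $ i) * (u s $ i \<bullet> x_step h s - b s $ i + H * (t - s + h))"
proof -
  let ?J = "{idx h s..<idx h t}" and ?K = "u s $ i \<bullet> x_step h s - b s $ i + H * (t - s + h)"
  \<comment> \<open>A nonzero multiplier means that constraint \<open>i\<close> is violated at node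
    \<open>j\<close>. Carrying this inequality back to \<open>s\<close> costs at most
    \<open>H * (t - s + h)\<close>, so \<open>?K\<close> is positive.\<close>
  have "0 \<le> (\<alpha> *\<^sub>R p h j) $ i * ?K" if j: "j \<in> ?J" for j
  proof (cases "p h j $ i = 0")
    case False
    let ?n = "node h j"
    have "0 < u ?n $ i \<bullet> X h j - b ?n $ i"
      using False by (simp add: p_def violation_nth max_def split: if_splits)
    also have "\<dots> = u s $ i \<bullet> x_step h s - b s $ i + (u ?n - u s) $ i \<bullet> X h j
        + u s $ i \<bullet> (X h j - x_step h s) - (b ?n - b s) $ i"
      by (simp add: inner_diff_left inner_diff_right)
    also have "\<dots> \<le> u s $ i \<bullet> x_step h s - b s $ i + (L * (t - s + h)) * N
        + U * ((t - s + h) * (W * B)) + L * (t - s + h)"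
    proof -
      have n: "norm (u ?n - u s) \<le> L * (t - s + h)" "norm (b ?n - b s) \<le> L * (t - s + h)"
        using order_trans[OF u_lip mult_left_mono[OF node_near L_nonneg]]
          order_trans[OF b_lip mult_left_mono[OF node_near L_nonneg]] j by auto
      have "(u ?n - u s) $ i \<bullet> X h j \<le> norm ((u ?n - u s) $ i) * norm (X h j)"
        by (rule norm_cauchy_schwarz)
      also have "\<dots> \<le> (L * (t - s + h)) * N"
        using order_trans[OF Finite_Cartesian_Product.norm_nth_le n(1)] X_bound L_nonneg h st
        by (intro mult_mono) auto
      finally have 1: "(u ?n - u s) $ i \<bullet> X h j \<le> (L * (t - s + h)) * N" .
      have "norm (X h j - x_step h s) \<le> real (j - idx h s) * h * (W * B)"
        unfolding x_step_def using j by (intro X_diff_le h) auto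
      also have "\<dots> \<le> real (idx h t - idx h s) * h * (W * B)"
        using j h const_bounds by (intro mult_right_mono) auto
      also have "\<dots> \<le> (t - s + h) * (W * B)" using idx_diff const_bounds by (intro mult_right_mono) auto
      finally have X: "norm (X h j - x_step h s) \<le> (t - s + h) * (W * B)" .
      have "u s $ i \<bullet> (X h j - x_step h s) \<le> norm (u s $ i) * norm (X h j - x_step h s)"
        by (rule norm_cauchy_schwarz)
      also have "\<dots> \<le> U * ((t - s + h) * (W * B))"
        using order_trans[OF Finite_Cartesian_Product.norm_nth_le u_bound] X const_bounds
        by (intro mult_mono) auto
      finally have 2: "u s $ i \<bullet> (X h j - x_step h s) \<le> U * ((t - s + h) * (W * B))" .
      have "\<bar>(b ?n - b s) $ i\<bar> \<le> L * (t - s + h)"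
        using order_trans[OF Finite_Cartesian_Product.norm_nth_le n(2)] by simp
      with 1 2 show ?thesis by linarith
    qed
    also have "\<dots> = ?K" by (simp add: H_def algebra_simps)
    finally show ?thesis using \<alpha>(1) by (auto intro!: mult_nonneg_nonneg simp: p_def violation_nth)
  qed simp
  then have "0 \<le> (\<Sum>j\<in>?J. (\<alpha> *\<^sub>R p h j) $ i * ?K)" by (rule sum_nonneg)
  also have "\<dots> = (\<Lambda>_step h t - \<Lambda>_step h s) $ i * ?K"
    unfolding \<Lambda>_diff[OF idx_mono] by (simp add: sum_distrib_right)
  finally show ?thesis by simp
qed

end

text \<open>Freezing the grid after \<open>t1\<close> makes the bound uniform in \<open>t\<close>
  and \<open>h\<close>, as the extraction of a subsequence requires.\<close>

lemma \<Lambda>_step_bound: "0 < h \<Longrightarrow> norm (\<Lambda>_step h t) \<le> B * (t1 - t0)"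
proof -
  assume h: "0 < h"
  have "real (idx h t) * h \<le> t1 - t0"
  proof (cases "idx h t = 0")
    case False
    then have "real (idx h t) \<le> (min t t1 - t0) / h" unfolding idx_def by linarith
    then have "real (idx h t) * h \<le> min t t1 - t0" using h by (simp add: field_simps)
    then show ?thesis by simp
  qed (use t01 in simp)
  then have "B * (real (idx h t) * h) \<le> B * (t1 - t0)" using const_bounds by (intro mult_left_mono)
  moreover have "norm (\<Lambda>_step h t) \<le> (\<Sum>j<idx h t. B * h)"
    unfolding \<Lambda>_step_def scaleR_sum_right using \<alpha>p_bound[OF h] by (intro sum_norm_le)
  ultimately show ?thesis by (simp add: mult_ac)
qed

lemma step_before: "0 < h \<Longrightarrow> t \<le> t0 \<Longrightarrow> x_step h t = x0"
proof -
  assume "0 < h" "t \<le> t0"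
  then have "(min t t1 - t0) / h \<le> 0" by (auto simp: divide_le_0_iff)
  then have "idx h t = 0" unfolding idx_def by linarith
  then show ?thesis by (simp add: x_step_def)
qed

text \<open>The residual at the last node up to \<open>t\<close> is bounded by
  \<open>p_bound\<close>; passing from that node to \<open>t\<close> adds only Lipschitz
  terms.\<close>

lemma step_feasibility:
  assumes h: "0 < h" and t: "t \<in> {t0..t1}"
  shows "u t $ i \<bullet> x_step h t - b t $ i \<le> F * h"
proof -
  let ?k = "idx h t"
  have q: "0 \<le> (t - t0) / h" using t h by simp
  have k: "?k = nat \<lfloor>(t - t0) / h\<rfloor>" using t by (simp add: idx_def)
  have "real ?k \<le> (t - t0) / h" "(t - t0) / h < real ?k + 1" using q unfolding k by linarith+
  then have d: "\<bar>t - node h ?k\<bar> \<le> h" using h by (simp add: node_def field_simps)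
  have "\<bar>p h ?k $ i\<bar> \<le> Q * h / \<theta>"
    using order_trans[OF Finite_Cartesian_Product.norm_nth_le p_bound[OF h]] by simp
  then have "u (node h ?k) $ i \<bullet> x_step h t - b (node h ?k) $ i \<le> Q * h / \<theta>"
    by (simp add: p_def violation_nth x_step_def)
  moreover have "(u t - u (node h ?k)) $ i \<bullet> x_step h t \<le> L * h * N"
  proof -
    have "(u t - u (node h ?k)) $ i \<bullet> x_step h t \<le> norm ((u t - u (node h ?k)) $ i) * norm (x_step h t)"
      by (rule norm_cauchy_schwarz)
    also have "\<dots> \<le> L * h * N"
      using order_trans[OF Finite_Cartesian_Product.norm_nth_le order_trans[OF u_lip mult_left_mono[OF d L_nonneg]]]
        X_bound L_nonneg h by (intro mult_mono) (auto simp: x_step_def)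
    finally show ?thesis .
  qed
  moreover have "\<bar>(b t - b (node h ?k)) $ i\<bar> \<le> L * h"
    using order_trans[OF Finite_Cartesian_Product.norm_nth_le order_trans[OF b_lip mult_left_mono[OF d L_nonneg]]]
    by simp
  moreover have "u t $ i \<bullet> x_step h t - b t $ i = u (node h ?k) $ i \<bullet> x_step h t - b (node h ?k) $ i
      + (u t - u (node h ?k)) $ i \<bullet> x_step h t - (b t - b (node h ?k)) $ i"
    by (simp add: inner_diff_left)
  ultimately have "u t $ i \<bullet> x_step h t - b t $ i \<le> Q * h / \<theta> + L * h * N + L * h"
    by linarith
  then show ?thesis by (simp add: F_def algebra_simps)
qed

end

text \<open>Boundedness yields no convergent subsequence in infinite dimension. The iterates are
  instead compared with sequences whose convergence comes from the multipliers.\<close>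

lemma convergent_if_approximable:
  fixes X :: "nat \<Rightarrow> 'b::complete_space"
  assumes approx: "\<And>e. 0 < e \<Longrightarrow> \<exists>Y. convergent Y \<and> (\<forall>\<^sub>F n in sequentially. dist (X n) (Y n) < e)"
  shows "convergent X"
proof (rule Cauchy_convergent, rule metric_CauchyI)
  fix e :: real assume "0 < e"
  then obtain Y where Y: "convergent Y" "\<forall>\<^sub>F n in sequentially. dist (X n) (Y n) < e / 3"
    using approx[of "e / 3"] by auto
  obtain K where K: "\<And>m n. K \<le> m \<Longrightarrow> K \<le> n \<Longrightarrow> dist (Y m) (Y n) < e / 3"
    using metric_CauchyD[OF convergent_Cauchy[OF Y(1)], of "e / 3"] \<open>0 < e\<close> by auto
  obtain K' where K': "\<And>n. K' \<le> n \<Longrightarrow> dist (X n) (Y n) < e / 3"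
    using Y(2) by (auto simp: eventually_sequentially)
  have "dist (X m) (X n) < e" if "max K K' \<le> m" "max K K' \<le> n" for m n
  proof -
    have "dist (X m) (X n) \<le> dist (X m) (Y m) + dist (Y m) (Y n) + dist (X n) (Y n)"
      by (smt (verit) dist_commute dist_triangle)
    then show ?thesis using K[of m n] K'[of m] K'[of n] that by simp
  qed
  then show "\<exists>K. \<forall>m\<ge>K. \<forall>n\<ge>K. dist (X m) (X n) < e" by blast
qed

lemma has_vector_derivative_0_if_quadratic:
  fixes r :: "real \<Rightarrow> 'a::real_normed_vector"
  assumes "\<And>s. norm (r s) \<le> C * (s - t)\<^sup>2"
  shows "(r has_vector_derivative 0) (at t)"
proof -
  have [simp]: "r t = 0" using assms[of t] by simp
  have "(r has_derivative (\<lambda>_. 0)) (at t)"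
  proof (rule has_derivativeI_sandwich[of 1])
    show "norm ((r s - r t) - 0) / norm (s - t) \<le> C * \<bar>s - t\<bar>" if "s \<noteq> t" for s
    proof -
      have "norm (r s) \<le> (C * \<bar>s - t\<bar>) * \<bar>s - t\<bar>"
        using assms[of s] by (simp add: power2_eq_square mult.assoc)
      then show ?thesis using that by (simp add: pos_divide_le_eq)
    qed
    show "((\<lambda>s. C * \<bar>s - t\<bar>) \<longlongrightarrow> 0) (at t)"
      by (auto intro!: tendsto_eq_intros)
  qed auto
  then show ?thesis by (simp add: has_vector_derivative_def)
qed

section \<open>The continuous-time limit\<close>

context penalized_scheme
begin

text \<open>The expansion telescopes over \<open>n\<close> equal pieces, each with an error of order
  \<open>1 / n\<^sup>2\<close>. The approximant involves the scheme only through finitely many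
  multiplier values. The \<open>+ 1\<close> accounts for \<open>h \<le> 1 / real n\<close>.\<close>

lemma x_step_approx:
  assumes h: "0 < h" "h \<le> 1 / real n" and n: "0 < n" and t: "t0 \<le> t"
  defines "s \<equiv> \<lambda>k. t0 + real k * ((t - t0) / real n)"
  shows "norm (x_step h t - (x0 - (\<Sum>k<n. combine (\<Lambda>_step h (s (Suc k)) - \<Lambda>_step h (s k)) (u (s k)))))
    \<le> G * (t - t0 + 1)\<^sup>2 / real n"
proof -
  let ?c = "\<lambda>k. combine (\<Lambda>_step h (s (Suc k)) - \<Lambda>_step h (s k)) (u (s k))"
  have s0: "x_step h (s 0) = x0" using h by (simp add: s_def step_before)
  have sn: "s n = t" using n by (simp add: s_def)
  have step: "s (Suc k) - s k = (t - t0) / real n" for k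
  proof -
    define c where "c = (t - t0) / real n"
    show ?thesis unfolding s_def c_def[symmetric] by (simp add: algebra_simps)
  qed
  have "x_step h t - x0 = (\<Sum>k<n. x_step h (s (Suc k)) - x_step h (s k))"
    using sum_lessThan_telescope[of "\<lambda>k. x_step h (s k)" n] by (simp add: s0 sn)
  then have "x_step h t - x0 + (\<Sum>k<n. ?c k) = (\<Sum>k<n. x_step h (s (Suc k)) - x_step h (s k) + ?c k)"
    by (simp only: sum.distrib)
  then have eq: "x_step h t - (x0 - (\<Sum>k<n. ?c k)) = (\<Sum>k<n. x_step h (s (Suc k)) - x_step h (s k) + ?c k)"
    by (simp only: diff_diff_eq2 diff_add_eq)
  have "norm (\<Sum>k<n. x_step h (s (Suc k)) - x_step h (s k) + ?c k) \<le> (\<Sum>k<n. G * ((t - t0 + 1) / real n)\<^sup>2)"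
  proof (rule sum_norm_le)
    fix k
    have "0 \<le> s (Suc k) - s k" unfolding step using t by simp
    then have "norm (x_step h (s (Suc k)) - x_step h (s k) + ?c k) \<le> G * (s (Suc k) - s k + h)\<^sup>2"
      by (intro x_step_expansion h) simp
    also have "\<dots> \<le> G * ((t - t0 + 1) / real n)\<^sup>2"
    proof (intro mult_left_mono power_mono)
      show "s (Suc k) - s k + h \<le> (t - t0 + 1) / real n"
        unfolding step add_divide_distrib using h by simp
      show "0 \<le> s (Suc k) - s k + h" unfolding step using h t by simp
    qed (rule const_bounds)
    finally show "norm (x_step h (s (Suc k)) - x_step h (s k) + ?c k) \<le> G * ((t - t0 + 1) / real n)\<^sup>2" .
  qed
  also have "\<dots> = G * (t - t0 + 1)\<^sup>2 / real n"
  proof -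
    have "real n * (G * (q / real n)\<^sup>2) = G * q\<^sup>2 / real n" for q
      using n by (simp add: field_simps power2_eq_square)
    then show ?thesis by (simp only: sum_constant card_lessThan)
  qed
  finally show ?thesis unfolding eq .
qed

text \<open>The multipliers are bounded in finite dimension, so a subsequence converges at all
  rational times; the Lipschitz bound up to \<open>h\<close> extends this to real times, and
  \<open>x_step_approx\<close> transfers it to the iterates.\<close>

lemma convergent_subsequence:
  obtains h \<Lambda> x where "\<forall>n. 0 < h n" "h \<longlonglongrightarrow> 0"
    "\<forall>t. (\<lambda>n. \<Lambda>_step (h n) t) \<longlonglongrightarrow> \<Lambda> t" "\<forall>t. (\<lambda>n. x_step (h n) t) \<longlonglongrightarrow> x t"
proof -
  obtain \<sigma> :: "nat \<Rightarrow> nat" where \<sigma>: "strict_mono \<sigma>"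
    "\<And>q. q \<in> \<rat> \<Longrightarrow> \<exists>l. (\<lambda>n. \<Lambda>_step (1 / real (Suc (\<sigma> n))) q) \<longlonglongrightarrow> l"
    by (rule function_convergent_subsequence[OF countable_rat, of "\<lambda>n. \<Lambda>_step (1 / real (Suc n))" "B * (t1 - t0)"])
      (auto intro: \<Lambda>_step_bound)
  define h where "h n = 1 / real (Suc (\<sigma> n))" for n
  have h: "0 < h n" for n by (simp add: h_def)
  have "(\<lambda>n. 1 / real (Suc n)) \<longlonglongrightarrow> 0" by (rule LIMSEQ_Suc[OF lim_1_over_n])
  from LIMSEQ_subseq_LIMSEQ[OF this \<sigma>(1)] have h0: "h \<longlonglongrightarrow> 0" by (simp add: h_def[abs_def] o_def)
  have h_less: "\<forall>\<^sub>F n in sequentially. h n < d" if "0 < d" for d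
    using order_tendstoD(2)[OF h0 that] .
  have "convergent (\<lambda>n. \<Lambda>_step (h n) t)" for t
  proof (rule convergent_if_approximable)
    fix e :: real assume e: "0 < e"
    \<comment> \<open>Both \<open>t - q\<close> and \<open>h n\<close> will be below
      \<open>d\<close>, so the gap is at most \<open>B * (2 * d)\<close>; \<open>B + 1\<close>
      avoids division by zero.\<close>
    define d where "d = e / (2 * (B + 1))"
    have d: "0 < d" "B * (2 * d) < e" using e const_bounds by (simp_all add: d_def field_simps)
    obtain q where q: "q \<in> \<rat>" "t - d < q" "q < t"
      using Rats_dense_in_real[of "t - d" t] d by auto
    have "\<forall>\<^sub>F n in sequentially. dist (\<Lambda>_step (h n) t) (\<Lambda>_step (h n) q) < e"
      using h_less[OF d(1)]
    proof eventually_elim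
      case (elim n)
      have "dist (\<Lambda>_step (h n) t) (\<Lambda>_step (h n) q) \<le> B * (t - q + h n)"
        unfolding dist_norm using q by (intro \<Lambda>_step_lip h) auto
      also have "\<dots> \<le> B * (2 * d)" using elim q const_bounds by (intro mult_left_mono) auto
      finally show ?case using d by linarith
    qed
    moreover have "convergent (\<lambda>n. \<Lambda>_step (h n) q)"
      using \<sigma>(2)[OF q(1)] by (simp add: convergent_def h_def)
    ultimately show "\<exists>Y. convergent Y \<and> (\<forall>\<^sub>F n in sequentially. dist (\<Lambda>_step (h n) t) (Y n) < e)"
      by blast
  qed
  then obtain \<Lambda> where \<Lambda>: "\<And>t. (\<lambda>n. \<Lambda>_step (h n) t) \<longlonglongrightarrow> \<Lambda> t"
    unfolding convergent_def by metis
  have "convergent (\<lambda>n. x_step (h n) t)" for t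
  proof (cases "t0 \<le> t")
    case False
    then show ?thesis using step_before[OF h, of t] by (simp add: convergent_const)
  next
    case True
    show ?thesis
    proof (rule convergent_if_approximable)
      fix e :: real assume e: "0 < e"
      obtain n :: nat where n: "max 1 (G * (t - t0 + 1)\<^sup>2 / e) < real n" using reals_Archimedean2 by blast
      then have n0: "0 < n" and ne: "G * (t - t0 + 1)\<^sup>2 / real n < e" using e by (auto simp: field_simps)
      define s where "s k = t0 + real k * ((t - t0) / real n)" for k
      let ?Y = "\<lambda>m. x0 - (\<Sum>k<n. combine (\<Lambda>_step (h m) (s (Suc k)) - \<Lambda>_step (h m) (s k)) (u (s k)))"
      have "?Y \<longlonglongrightarrow> x0 - (\<Sum>k<n. combine (\<Lambda> (s (Suc k)) - \<Lambda> (s k)) (u (s k)))"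
        by (intro tendsto_intros combine.tendsto \<Lambda>)
      moreover have "\<forall>\<^sub>F m in sequentially. h m < 1 / real n" using n0 by (intro h_less) simp
      then have "\<forall>\<^sub>F m in sequentially. dist (x_step (h m) t) (?Y m) < e"
      proof (rule eventually_mono)
        fix m assume "h m < 1 / real n"
        then have "dist (x_step (h m) t) (?Y m) \<le> G * (t - t0 + 1)\<^sup>2 / real n"
          unfolding dist_norm s_def using n0 True h by (intro x_step_approx) auto
        then show "dist (x_step (h m) t) (?Y m) < e" using ne by simp
      qed
      ultimately show "\<exists>Y. convergent Y \<and> (\<forall>\<^sub>F m in sequentially. dist (x_step (h m) t) (Y m) < e)"
        unfolding convergent_def by blast
    qed
  qed
  then obtain x where "\<And>t. (\<lambda>n. x_step (h n) t) \<longlonglongrightarrow> x t"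
    unfolding convergent_def by metis
  then show thesis using that h h0 \<Lambda> by blast
qed

text \<open>Each estimate survives the limit with \<open>h\<close> replaced by 0. Wherever all
  multipliers are differentiable, their derivatives are nonnegative, complementary weights for the
  normal cone.\<close>

lemma solution_exists:
  "\<exists>x K E. K-lipschitz_on UNIV x \<and> x t0 = x0 \<and> (\<forall>t\<in>{t0..t1}. x t \<in> moving_polyhedron u b t) \<and>
    negligible E \<and> (\<forall>t\<in>{t0<..<t1} - E. \<exists>x'. (x has_vector_derivative x') (at t) \<and>
      - x' \<in> normal_cone (moving_polyhedron u b t) (x t))"
proof -
  obtain h \<Lambda> x where lims: "\<forall>n. 0 < h n" "h \<longlonglongrightarrow> 0"
    "\<forall>t. (\<lambda>n. \<Lambda>_step (h n) t) \<longlonglongrightarrow> \<Lambda> t" "\<forall>t. (\<lambda>n. x_step (h n) t) \<longlonglongrightarrow> x t"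
    by (rule convergent_subsequence)
  then have h: "\<And>n. 0 < h n" "h \<longlonglongrightarrow> 0"
    and \<Lambda>: "\<And>t. (\<lambda>n. \<Lambda>_step (h n) t) \<longlonglongrightarrow> \<Lambda> t" and x: "\<And>t. (\<lambda>n. x_step (h n) t) \<longlonglongrightarrow> x t"
    by blast+
  have \<Lambda>i: "(\<lambda>n. \<Lambda>_step (h n) t $ i) \<longlonglongrightarrow> \<Lambda> t $ i" for t i
    by (rule tendsto_vec_nth[OF \<Lambda>])
  have lim_h: "(\<lambda>n. C * (t - s + h n)) \<longlonglongrightarrow> C * (t - s)" for C s t
    by (rule tendsto_eq_intros refl h(2))+ simp
  have \<Lambda>_lip: "norm (\<Lambda> t - \<Lambda> s) \<le> B * (t - s)" if "s \<le> t" for s t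
    by (rule LIMSEQ_le[OF tendsto_norm[OF tendsto_diff[OF \<Lambda> \<Lambda>]] lim_h]) (use that \<Lambda>_step_lip[OF h(1)] in blast)
  have \<Lambda>_mono: "\<Lambda> s $ i \<le> \<Lambda> t $ i" if "s \<le> t" for s t i
    by (rule LIMSEQ_le[OF \<Lambda>i \<Lambda>i]) (use that \<Lambda>_step_mono[OF h(1)] in blast)
  have x_lip: "norm (x t - x s) \<le> W * B * (t - s)" if "s \<le> t" for s t
    by (rule LIMSEQ_le[OF tendsto_norm[OF tendsto_diff[OF x x]] lim_h]) (use that x_step_lip[OF h(1)] in blast)
  have expansion: "norm (x t - x s + combine (\<Lambda> t - \<Lambda> s) (u s)) \<le> G * (t - s)\<^sup>2" if "s \<le> t" for s t
  proof (rule LIMSEQ_le)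
    show "(\<lambda>n. norm (x_step (h n) t - x_step (h n) s + combine (\<Lambda>_step (h n) t - \<Lambda>_step (h n) s) (u s)))
        \<longlonglongrightarrow> norm (x t - x s + combine (\<Lambda> t - \<Lambda> s) (u s))"
      by (intro tendsto_intros combine.tendsto \<Lambda> x)
    show "(\<lambda>n. G * (t - s + h n)\<^sup>2) \<longlonglongrightarrow> G * (t - s)\<^sup>2"
      by (rule tendsto_eq_intros refl h(2))+ simp
  qed (use that x_step_expansion[OF h(1)] in blast)
  have complementarity: "0 \<le> (\<Lambda> t $ i - \<Lambda> s $ i) * (u s $ i \<bullet> x s - b s $ i + H * (t - s))" if "s \<le> t" for s t i
  proof (rule LIMSEQ_le_const)
    show "(\<lambda>n. (\<Lambda>_step (h n) t $ i - \<Lambda>_step (h n) s $ i) * (u s $ i \<bullet> x_step (h n) s - b s $ i + H * (t - s + h n)))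
        \<longlonglongrightarrow> (\<Lambda> t $ i - \<Lambda> s $ i) * (u s $ i \<bullet> x s - b s $ i + H * (t - s))"
      by (intro tendsto_intros \<Lambda>i x lim_h)
  qed (use that step_complementarity[OF h(1)] in blast)
  have feasible: "u t $ i \<bullet> x t \<le> b t $ i" if "t \<in> {t0..t1}" for t i
  proof -
    have "u t $ i \<bullet> x t - b t $ i \<le> F * 0"
    proof (rule LIMSEQ_le)
      show "(\<lambda>n. u t $ i \<bullet> x_step (h n) t - b t $ i) \<longlonglongrightarrow> u t $ i \<bullet> x t - b t $ i"
        by (intro tendsto_intros x)
      show "(\<lambda>n. F * h n) \<longlonglongrightarrow> F * 0" by (intro tendsto_intros h)
    qed (use that step_feasibility[OF h(1)] in blast)
    then show ?thesis by simp
  qed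
  \<comment> \<open>\<open>expansion\<close> freezes \<open>u\<close> at the earlier time. For
    \<open>s\<close> before \<open>t\<close>, switching to \<open>u t\<close> costs one more
    \<open>G * (s - t)\<^sup>2\<close>, hence the factor 2.\<close>
  have two_sided: "norm (x s - x t + combine (\<Lambda> s - \<Lambda> t) (u t)) \<le> 2 * G * (s - t)\<^sup>2" for s t
  proof (cases "t \<le> s")
    case True
    have "0 \<le> G * (s - t)\<^sup>2" using const_bounds by simp
    then show ?thesis using expansion[OF True] by linarith
  next
    case False
    let ?r = "x t - x s + combine (\<Lambda> t - \<Lambda> s) (u s)" and ?c = "combine (\<Lambda> t - \<Lambda> s) (u t - u s)"
    have "x s - x t + combine (\<Lambda> s - \<Lambda> t) (u t) = - ?r - ?c"
      by (simp add: combine.diff_left combine.diff_right)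
    then have "norm (x s - x t + combine (\<Lambda> s - \<Lambda> t) (u t)) \<le> norm ?r + norm ?c"
      by (metis norm_minus_cancel norm_triangle_ineq4)
    moreover have "norm ?r \<le> G * (s - t)\<^sup>2"
      using expansion[of s t] False by (simp add: power2_commute)
    moreover have "norm ?c \<le> G * (s - t)\<^sup>2"
    proof -
      have "norm ?c \<le> real CARD('m) * norm (\<Lambda> t - \<Lambda> s) * norm (u t - u s)" by (rule norm_combine_le)
      also have "\<dots> \<le> real CARD('m) * (B * (t - s)) * (L * (t - s))"
        using \<Lambda>_lip[of s t] u_lip[of t s] False const_bounds L_nonneg by (intro mult_mono) auto
      also have "\<dots> = G * (s - t)\<^sup>2" by (simp add: G_def power2_eq_square algebra_simps)
      finally show ?thesis .
    qed
    ultimately show ?thesis by simp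
  qed
  define E where "E = (\<Union>i. {t. \<not> (\<lambda>t. \<Lambda> t $ i) differentiable (at t)})"
  have "negligible E"
    unfolding E_def
  proof (rule negligible_Union)
    fix S assume "S \<in> range (\<lambda>i. {t. \<not> (\<lambda>t. \<Lambda> t $ i) differentiable (at t)})"
    then obtain i where S: "S = {t. \<not> (\<lambda>t. \<Lambda> t $ i) differentiable (at t)}" by blast
    have "B-lipschitz_on UNIV (\<lambda>t. \<Lambda> t $ i)"
    proof (rule lipschitz_onI)
      fix s t
      have "dist (\<Lambda> s) (\<Lambda> t) \<le> B * dist s t"
        using \<Lambda>_lip[of s t] \<Lambda>_lip[of t s] by (cases "s \<le> t") (auto simp: dist_norm norm_minus_commute)
      then show "dist (\<Lambda> s $ i) (\<Lambda> t $ i) \<le> B * dist s t"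
        using dist_vec_nth_le order_trans by blast
    qed (use const_bounds in simp)
    then show "negligible S"
      unfolding S using \<Lambda>_mono by (intro negligible_not_differentiable_mono_lipschitz monoI)
  qed simp
  have "\<exists>x'. (x has_vector_derivative x') (at t) \<and> - x' \<in> normal_cone (moving_polyhedron u b t) (x t)"
    if t: "t \<in> {t0<..<t1} - E" for t
  proof -
    have "\<exists>d. ((\<lambda>t. \<Lambda> t $ i) has_real_derivative d) (at t)" for i
      using t by (auto simp: E_def real_differentiable_def)
    then obtain d where d: "\<And>i. ((\<lambda>t. \<Lambda> t $ i) has_real_derivative d i) (at t)" by metis
    define x' where "x' = - (\<Sum>i\<in>UNIV. d i *\<^sub>R u t $ i)"
    define r where "r s = x s - x t + combine (\<Lambda> s - \<Lambda> t) (u t)" for s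
    have "(r has_vector_derivative 0) (at t)"
      by (rule has_vector_derivative_0_if_quadratic[of _ "2 * G"]) (simp add: r_def two_sided)
    \<comment> \<open>With \<open>u\<close> frozen at \<open>t\<close>, this writes \<open>x\<close>
      as \<open>r\<close> plus constants minus scalar functions times fixed vectors.\<close>
    then have "((\<lambda>s. r s + x t + combine (\<Lambda> t) (u t) - (\<Sum>i\<in>UNIV. \<Lambda> s $ i *\<^sub>R u t $ i)) has_vector_derivative x') (at t)"
      unfolding x'_def
      by (auto intro!: derivative_eq_intros d)
    moreover have "(\<lambda>s. r s + x t + combine (\<Lambda> t) (u t) - (\<Sum>i\<in>UNIV. \<Lambda> s $ i *\<^sub>R u t $ i)) = x"
      by (simp add: r_def combine.diff_left fun_eq_iff flip: combine_def)
    ultimately have x': "(x has_vector_derivative x') (at t)" by simp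
    \<comment> \<open>Monotonicity and complementarity compare \<open>t\<close> with later times, so
      right-hand quotients are used.\<close>
    have quot: "((\<lambda>s. (\<Lambda> s $ i - \<Lambda> t $ i) / (s - t)) \<longlongrightarrow> d i) (at_right t)" for i
      using has_field_derivative_at_within[OF d[of i], of "{t<..}"] by (simp add: has_field_derivative_iff)
    have d_nonneg: "0 \<le> d i" for i
    proof (rule tendsto_lowerbound[OF quot])
      show "\<forall>\<^sub>F s in at_right t. 0 \<le> (\<Lambda> s $ i - \<Lambda> t $ i) / (s - t)"
        using \<Lambda>_mono[of t _ i] by (auto simp: eventually_at_filter intro!: always_eventually divide_nonneg_pos)
    qed simp
    \<comment> \<open>After division by \<open>s - t\<close> the slack \<open>H * (s - t)\<close>
      still tends to 0. With feasibility, a positive \<open>d i\<close> forces constraint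
      \<open>i\<close> to be active.\<close>
    have d_compl: "0 \<le> d i * (u t $ i \<bullet> x t - b t $ i)" for i
    proof (rule tendsto_lowerbound)
      show "((\<lambda>s. (\<Lambda> s $ i - \<Lambda> t $ i) / (s - t) * (u t $ i \<bullet> x t - b t $ i + H * (s - t)))
          \<longlongrightarrow> d i * (u t $ i \<bullet> x t - b t $ i)) (at_right t)"
        by (rule tendsto_eq_intros quot refl)+ simp
      show "\<forall>\<^sub>F s in at_right t. 0 \<le> (\<Lambda> s $ i - \<Lambda> t $ i) / (s - t) * (u t $ i \<bullet> x t - b t $ i + H * (s - t))"
        using complementarity[of t _ i]
        by (auto simp: eventually_at_filter intro!: always_eventually divide_nonneg_pos)
    qed simp
    have "- x' \<bullet> (y - x t) \<le> 0" if y: "y \<in> moving_polyhedron u b t" for y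
    proof -
      have "- x' \<bullet> (y - x t) = (\<Sum>i\<in>UNIV. d i * (u t $ i \<bullet> (y - x t)))"
        by (simp add: x'_def inner_sum_left)
      also have "\<dots> \<le> 0"
      proof (rule sum_nonpos)
        fix i
        have "d i * (u t $ i \<bullet> (y - x t)) \<le> d i * (b t $ i - u t $ i \<bullet> x t)"
          using y d_nonneg by (intro mult_left_mono) (auto simp: moving_polyhedron_def inner_diff_right)
        also have "\<dots> \<le> 0" using d_compl[of i] by (simp add: algebra_simps)
        finally show "d i * (u t $ i \<bullet> (y - x t)) \<le> 0" .
      qed
      finally show ?thesis .
    qed
    moreover have "x t \<in> moving_polyhedron u b t"
      using feasible[of t] t by (simp add: moving_polyhedron_def)
    ultimately show ?thesis using x' by (auto simp: normal_cone_def)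
  qed
  moreover have "(W * B)-lipschitz_on UNIV x"
  proof (rule lipschitz_onI)
    show "dist (x s) (x t) \<le> W * B * dist s t" for s t
      using x_lip[of s t] x_lip[of t s] by (cases "s \<le> t") (auto simp: dist_norm norm_minus_commute)
  qed (use const_bounds in simp)
  moreover have "x t0 = x0"
    using LIMSEQ_unique[OF x[of t0]] step_before[OF h(1), of t0] by simp
  ultimately show ?thesis
    using feasible \<open>negligible E\<close> unfolding moving_polyhedron_def by blast
qed

end

section \<open>Uniqueness and gluing\<close>

text \<open>Normal cones are monotone: adding the two cone inequalities gives
  \<open>(x' - y') \<bullet> (x s - y s) \<le> 0\<close>, so the squared distance cannot grow from
  its initial value 0.\<close>

lemma sweeping_solution_unique:
  fixes x y :: "real \<Rightarrow> 'a::real_inner"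
  assumes lip: "K-lipschitz_on {0..T} x" "K'-lipschitz_on {0..T} y"
    and x: "sweeping_solution T C x0 x" and y: "sweeping_solution T C x0 y" and t: "t \<in> {0..T}"
  shows "y t = x t"
proof -
  define w where "w s = x s - y s" for s
  define f where "f s = w s \<bullet> w s" for s
  define R where "R = K + K'"
  have R: "0 \<le> R" using lipschitz_on_nonneg[OF lip(1)] lipschitz_on_nonneg[OF lip(2)] by (simp add: R_def)
  have w0: "w 0 = 0" using x y by (simp add: w_def sweeping_solution_def)
  have w_lip: "norm (w s - w r) \<le> R * \<bar>s - r\<bar>" if "s \<in> {0..t}" "r \<in> {0..t}" for s r
  proof -
    have "norm (x s - x r) \<le> K * \<bar>s - r\<bar>" "norm (y s - y r) \<le> K' * \<bar>s - r\<bar>"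
      using lipschitz_onD[OF lip(1), of s r] lipschitz_onD[OF lip(2), of s r] that t
      by (auto simp: dist_norm)
    moreover have "w s - w r = (x s - x r) - (y s - y r)" by (simp add: w_def)
    moreover have "norm ((x s - x r) - (y s - y r)) \<le> norm (x s - x r) + norm (y s - y r)"
      by (rule norm_triangle_ineq4)
    ultimately show ?thesis by (simp add: R_def distrib_right)
  qed
  have w_bound: "norm (w s) \<le> R * t" if "s \<in> {0..t}" for s
  proof -
    have "norm (w s) \<le> R * s" using w_lip[of s 0] w0 that t by simp
    also have "\<dots> \<le> R * t" using R that by (intro mult_left_mono) auto
    finally show ?thesis .
  qed
  have f_lip: "(2 * (R * t) * R)-lipschitz_on {0..t} f"
  proof (rule lipschitz_onI)
    fix s r assume sr: "s \<in> {0..t}" "r \<in> {0..t}"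
    have "f s - f r = (w s + w r) \<bullet> (w s - w r)"
      by (simp add: f_def inner_add_left inner_diff_right inner_commute[of "w r" "w s"])
    then have "\<bar>f s - f r\<bar> \<le> norm (w s + w r) * norm (w s - w r)"
      by (simp add: Cauchy_Schwarz_ineq2)
    also have "\<dots> \<le> (2 * (R * t)) * (R * \<bar>s - r\<bar>)"
      using norm_triangle_ineq[of "w s" "w r"] w_bound[OF sr(1)] w_bound[OF sr(2)] w_lip[OF sr] R t
      by (intro mult_mono) auto
    finally show "dist (f s) (f r) \<le> 2 * (R * t) * R * dist s r" by (simp add: dist_real_def mult_ac)
  qed (use R t in simp)
  define ok where "ok v s \<longleftrightarrow> (\<exists>v'. (v has_vector_derivative v') (at s within {0..T}) \<and> - v' \<in> normal_cone (C s) (v s))" for v s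
  have "AE s\<in>{0..T} in lebesgue. ok x s \<and> ok y s"
    using x y unfolding sweeping_solution_def ok_def by auto
  then obtain E where E: "{s \<in> space lebesgue. \<not> (s \<in> {0..T} \<longrightarrow> ok x s \<and> ok y s)} \<subseteq> E"
    "emeasure lebesgue E = 0" "E \<in> sets lebesgue"
    by (rule AE_E)
  have good: "ok x s \<and> ok y s" if "s \<in> {0..T} - E" for s
    using E(1) that by (simp add: subset_eq) blast
  have "f t \<le> f 0"
  proof (rule lipschitz_nonincreasing_if_ae_derivative_nonpos[OF f_lip])
    show "0 \<le> t" using t by simp
    show "negligible E" using E(2,3) unfolding negligible_iff_null_sets by (intro null_setsI)
    fix s assume s: "s \<in> {0..t} - E"
    then have "s \<in> {0..T} - E" using t by auto
    then obtain x' y' where x': "(x has_vector_derivative x') (at s within {0..T})" "- x' \<in> normal_cone (C s) (x s)"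
      and y': "(y has_vector_derivative y') (at s within {0..T})" "- y' \<in> normal_cone (C s) (y s)"
      using good unfolding ok_def by blast
    have "(w has_vector_derivative x' - y') (at s within {0..T})"
      unfolding w_def by (intro derivative_intros x' y')
    then have w': "(w has_vector_derivative x' - y') (at s within {0..t})"
      by (rule has_vector_derivative_within_subset) (use t in auto)
    have "(f has_vector_derivative w s \<bullet> (x' - y') + (x' - y') \<bullet> w s) (at s within {0..t})"
      unfolding f_def by (rule bounded_bilinear.has_vector_derivative[OF bounded_bilinear_inner w' w'])
    then have "(f has_real_derivative 2 * ((x' - y') \<bullet> w s)) (at s within {0..t})"
      by (simp add: has_real_derivative_iff_has_vector_derivative inner_commute)
    moreover have "(x' - y') \<bullet> w s \<le> 0"
    proof -
      \<comment> \<open>The state constraint makes each trajectory an admissible test point for the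
        other's normal cone.\<close>
      have "x s \<in> C s" "y s \<in> C s" using x y s t by (auto simp: sweeping_solution_def)
      then have "- x' \<bullet> (y s - x s) \<le> 0" "- y' \<bullet> (x s - y s) \<le> 0"
        using x'(2) y'(2) by (auto simp: normal_cone_def)
      then show ?thesis by (simp add: w_def inner_diff_left inner_diff_right)
    qed
    ultimately show "\<exists>d\<le>0. (f has_real_derivative d) (at s within {0..t})"
      by (intro exI[of _ "2 * ((x' - y') \<bullet> w s)"]) auto
  qed
  then have "w t = 0" using w0 by (simp add: f_def flip: power2_norm_eq_inner)
  then show ?thesis by (simp add: w_def)
qed

text \<open>The inclusion is required only inside the interval, where two-sided derivatives make
  sense; an explicit null set makes pieces easy to join.\<close>

definition sweeping_solution_on :: "real \<Rightarrow> real \<Rightarrow> (real \<Rightarrow> 'a::real_inner set) \<Rightarrow> 'a \<Rightarrow> (real \<Rightarrow> 'a) \<Rightarrow> bool" where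
  "sweeping_solution_on a c C y x \<longleftrightarrow>
     (\<exists>K. K-lipschitz_on {a..c} x) \<and> x a = y \<and> (\<forall>t\<in>{a..c}. x t \<in> C t) \<and>
     (\<exists>E. negligible E \<and> (\<forall>t\<in>{a<..<c} - E.
        \<exists>x'. (x has_vector_derivative x') (at t) \<and> - x' \<in> normal_cone (C t) (x t)))"

lemma sweeping_solution_on_glue:
  assumes x1: "sweeping_solution_on a m C y x1" and x2: "sweeping_solution_on m c C (x1 m) x2"
    and "a \<le> m" "m \<le> c"
  shows "sweeping_solution_on a c C y (\<lambda>t. if t \<le> m then x1 t else x2 t)" (is "sweeping_solution_on a c C y ?x")
proof -
  obtain K1 K2 where K: "K1-lipschitz_on {a..m} x1" "K2-lipschitz_on {m..c} x2"
    using x1 x2 by (auto simp: sweeping_solution_on_def)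
  obtain E1 E2 where E: "negligible E1" "negligible E2"
    and E1: "\<And>t. t \<in> {a<..<m} - E1 \<Longrightarrow> \<exists>x'. (x1 has_vector_derivative x') (at t) \<and> - x' \<in> normal_cone (C t) (x1 t)"
    and E2: "\<And>t. t \<in> {m<..<c} - E2 \<Longrightarrow> \<exists>x'. (x2 has_vector_derivative x') (at t) \<and> - x' \<in> normal_cone (C t) (x2 t)"
    using x1 x2 unfolding sweeping_solution_on_def by metis
  have "(max K1 K2)-lipschitz_on {a..c} ?x"
    by (rule lipschitz_on_concat_max[OF K]) (use x2 in \<open>simp add: sweeping_solution_on_def\<close>)
  moreover have "?x a = y" using x1 \<open>a \<le> m\<close> by (simp add: sweeping_solution_on_def)
  moreover have "\<forall>t\<in>{a..c}. ?x t \<in> C t"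
    using x1 x2 by (auto simp: sweeping_solution_on_def)
  \<comment> \<open>The two pieces may meet with different slopes, so \<open>m\<close> joins the
    exceptional set.\<close>
  moreover have "negligible (insert m (E1 \<union> E2))" using E by simp
  moreover have "\<exists>x'. (?x has_vector_derivative x') (at t) \<and> - x' \<in> normal_cone (C t) (?x t)"
    if t: "t \<in> {a<..<c} - insert m (E1 \<union> E2)" for t
  proof (cases "t < m")
    case True
    then obtain x' where x': "(x1 has_vector_derivative x') (at t)" "- x' \<in> normal_cone (C t) (x1 t)"
      using E1[of t] t by auto
    have "(?x has_vector_derivative x') (at t)"
      by (rule has_vector_derivative_transform_within_open[OF x'(1), of "{..<m}"]) (use True in auto)
    then show ?thesis using x'(2) True by auto
  next
    case False
    then have "m < t" using t by auto
    then obtain x' where x': "(x2 has_vector_derivative x') (at t)" "- x' \<in> normal_cone (C t) (x2 t)"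
      using E2[of t] t by auto
    have "(?x has_vector_derivative x') (at t)"
      by (rule has_vector_derivative_transform_within_open[OF x'(1), of "{m<..}"]) (use \<open>m < t\<close> in auto)
    then show ?thesis using x'(2) \<open>m < t\<close> by auto
  qed
  ultimately show ?thesis unfolding sweeping_solution_on_def by blast
qed

text \<open>Clamping time to \<open>{a..c}\<close> extends the control to the whole line with the
  same Lipschitz constant and margin, so the scheme applies.\<close>

lemma sweeping_solution_on_exists_common_slater_point:
  fixes u :: "real \<Rightarrow> 'a::{real_inner, complete_space} ^ 'm" and b :: "real \<Rightarrow> real ^ 'm"
  assumes u: "\<And>s t. s \<in> {a..c} \<Longrightarrow> t \<in> {a..c} \<Longrightarrow> norm (u t - u s) \<le> L * \<bar>t - s\<bar>"
    and b: "\<And>s t. s \<in> {a..c} \<Longrightarrow> t \<in> {a..c} \<Longrightarrow> norm (b t - b s) \<le> L * \<bar>t - s\<bar>"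
    and "0 \<le> L" "a \<le> c" "0 < \<delta>"
    and slater: "\<And>t i. t \<in> {a..c} \<Longrightarrow> u t $ i \<bullet> z \<le> b t $ i - \<delta>"
    and y: "y \<in> moving_polyhedron u b a"
  shows "\<exists>x. sweeping_solution_on a c (moving_polyhedron u b) y x"
proof -
  define cl where "cl t = max a (min c t)" for t
  have cl: "cl t \<in> {a..c}" "\<bar>cl t - cl s\<bar> \<le> \<bar>t - s\<bar>" for s t
    using \<open>a \<le> c\<close> by (auto simp: cl_def)
  have cl_id: "cl t = t" if "t \<in> {a..c}" for t using that by (simp add: cl_def)
  define U where "U = norm (u a) + L * (c - a) + 1"
  have U: "0 < U" using \<open>0 \<le> L\<close> \<open>a \<le> c\<close> unfolding U_def
    by (smt (verit) mult_nonneg_nonneg norm_ge_zero)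
  define M where "M = norm (y - z) + 1"
  have M: "0 < M" unfolding M_def by (rule add_nonneg_pos) simp_all
  \<comment> \<open>The largest step size meeting both upper bounds; \<open>U\<close> and
    \<open>M\<close> carry an added 1 to be positive.\<close>
  define \<alpha> where "\<alpha> = min (1 / (real CARD('m) * U)\<^sup>2) (M\<^sup>2 / \<delta>\<^sup>2)"
  interpret penalized_scheme "\<lambda>t. u (cl t)" "\<lambda>t. b (cl t)" z y a c L U \<delta> M \<alpha>
  proof
    show "norm (u (cl t) - u (cl s)) \<le> L * \<bar>t - s\<bar>" for s t
      using u[OF cl(1) cl(1)] mult_left_mono[OF cl(2) \<open>0 \<le> L\<close>] order_trans by blast
    show "norm (b (cl t) - b (cl s)) \<le> L * \<bar>t - s\<bar>" for s t
      using b[OF cl(1) cl(1)] mult_left_mono[OF cl(2) \<open>0 \<le> L\<close>] order_trans by blast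
    show "norm (u (cl t)) \<le> U" for t
    proof -
      have "norm (u (cl t) - u a) \<le> L * \<bar>cl t - a\<bar>" using cl(1)[of t] \<open>a \<le> c\<close> by (intro u) auto
      also have "\<dots> \<le> L * (c - a)" using cl(1)[of t] \<open>0 \<le> L\<close> by (intro mult_left_mono) auto
      finally show ?thesis using norm_triangle_sub[of "u (cl t)" "u a"] by (simp add: U_def)
    qed
    show "u (cl t) $ i \<bullet> z \<le> b (cl t) $ i - \<delta>" for t i by (rule slater[OF cl(1)])
    show "norm (y - z) \<le> M" by (simp add: M_def)
    show "0 < \<alpha>" using U M \<open>0 < \<delta>\<close> by (simp add: \<alpha>_def)
    show "\<alpha> * (real CARD('m) * U)\<^sup>2 \<le> 1"
    proof -
      have "\<alpha> \<le> 1 / (real CARD('m) * U)\<^sup>2" by (simp add: \<alpha>_def)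
      moreover have "0 < (real CARD('m) * U)\<^sup>2" using U by simp
      ultimately show ?thesis by (simp only: pos_le_divide_eq)
    qed
    show "\<alpha> * \<delta>\<^sup>2 \<le> M\<^sup>2"
    proof -
      have "\<alpha> \<le> M\<^sup>2 / \<delta>\<^sup>2" by (simp add: \<alpha>_def)
      moreover have "0 < \<delta>\<^sup>2" using \<open>0 < \<delta>\<close> by simp
      ultimately show ?thesis by (simp only: pos_le_divide_eq)
    qed
    show "u (cl a) $ i \<bullet> y \<le> b (cl a) $ i" for i
      using y cl_id[of a] \<open>a \<le> c\<close> by (simp add: moving_polyhedron_def)
  qed (use assms M in auto)
  have C: "moving_polyhedron (\<lambda>t. u (cl t)) (\<lambda>t. b (cl t)) t = moving_polyhedron u b t" if "t \<in> {a..c}" for t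
    using cl_id[OF that] by (simp add: moving_polyhedron_def)
  obtain x K E where x: "K-lipschitz_on UNIV x" "x a = y"
    "\<And>t. t \<in> {a..c} \<Longrightarrow> x t \<in> moving_polyhedron u b t" "negligible E"
    "\<And>t. t \<in> {a<..<c} - E \<Longrightarrow> \<exists>x'. (x has_vector_derivative x') (at t) \<and> - x' \<in> normal_cone (moving_polyhedron u b t) (x t)"
    using solution_exists by (auto simp: C)
  have "K-lipschitz_on {a..c} x" by (rule lipschitz_on_subset[OF x(1)]) simp
  then have "sweeping_solution_on a c (moving_polyhedron u b) y x"
    unfolding sweeping_solution_on_def using x(2-) by blast
  then show ?thesis by blast
qed

text \<open>There are finitely many constraints, so the smallest slack at \<open>t\<close> is
  positive, and by Lipschitz continuity half of it survives nearby.\<close>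

lemma slater_point_locally_common:
  fixes u :: "real \<Rightarrow> 'a::real_inner ^ 'm" and b :: "real \<Rightarrow> real ^ 'm"
  assumes u: "\<And>s. s \<in> S \<Longrightarrow> norm (u s - u t) \<le> L * \<bar>s - t\<bar>"
    and b: "\<And>s. s \<in> S \<Longrightarrow> norm (b s - b t) \<le> L * \<bar>s - t\<bar>"
    and "0 \<le> L" and z: "\<And>i. u t $ i \<bullet> z < b t $ i"
  shows "\<exists>\<delta>>0. \<exists>d>0. \<forall>s\<in>S. \<bar>s - t\<bar> < d \<longrightarrow> (\<forall>i. u s $ i \<bullet> z \<le> b s $ i - \<delta>)"
proof -
  define \<delta> where "\<delta> = Min (range (\<lambda>i. b t $ i - u t $ i \<bullet> z)) / 2"
  have \<delta>: "0 < \<delta>" using z by (simp add: \<delta>_def)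
  have t: "u t $ i \<bullet> z \<le> b t $ i - 2 * \<delta>" for i
  proof -
    have "2 * \<delta> \<le> b t $ i - u t $ i \<bullet> z" by (simp add: \<delta>_def)
    then show ?thesis by simp
  qed
  \<comment> \<open>The rate at which the slack of \<open>z\<close> can shrink, plus 1 for
    positivity.\<close>
  define R where "R = L * norm z + L + 1"
  have R: "0 < R" using \<open>0 \<le> L\<close> unfolding R_def by (smt (verit) mult_nonneg_nonneg norm_ge_zero)
  have "u s $ i \<bullet> z \<le> b s $ i - \<delta>" if s: "s \<in> S" "\<bar>s - t\<bar> < \<delta> / R" for s i
  proof -
    have "(u s - u t) $ i \<bullet> z \<le> norm ((u s - u t) $ i) * norm z" by (rule norm_cauchy_schwarz)
    also have "\<dots> \<le> (L * \<bar>s - t\<bar>) * norm z"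
      using order_trans[OF Finite_Cartesian_Product.norm_nth_le u[OF s(1)]] by (intro mult_right_mono) auto
    finally have 1: "(u s - u t) $ i \<bullet> z \<le> (L * \<bar>s - t\<bar>) * norm z" .
    have 2: "\<bar>(b s - b t) $ i\<bar> \<le> L * \<bar>s - t\<bar>"
      using order_trans[OF Finite_Cartesian_Product.norm_nth_le b[OF s(1)]] by simp
    have "(L * \<bar>s - t\<bar>) * norm z + L * \<bar>s - t\<bar> \<le> R * \<bar>s - t\<bar>" by (simp add: R_def algebra_simps)
    also have "\<dots> \<le> \<delta>" using s(2) R by (simp add: field_simps)
    finally have "(L * \<bar>s - t\<bar>) * norm z + L * \<bar>s - t\<bar> \<le> \<delta>" .
    moreover have "u s $ i \<bullet> z - b s $ i = (u t $ i \<bullet> z - b t $ i) + (u s - u t) $ i \<bullet> z - (b s - b t) $ i"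
      by (simp add: inner_diff_left)
    ultimately show ?thesis using 1 2 t[of i] by linarith
  qed
  then show ?thesis using \<delta> R by (intro exI[of _ \<delta>] conjI exI[of _ "\<delta> / R"]) auto
qed

theorem theorem2:
  fixes T :: real
    and u :: "real \<Rightarrow> ('a::{real_inner, complete_space}) ^ 'm"
    and b :: "real \<Rightarrow> real ^ 'm"
    and x0 :: 'a
  assumes separable: "separable_space (euclidean :: 'a topology)"
    and T_pos: "T > 0"
    and control_lipschitz: "\<exists>L. L-lipschitz_on {0..T} (\<lambda>t. (u t, b t))"
    and slater: "uniform_slater T u b"
    and initial: "x0 \<in> moving_polyhedron u b 0"
  shows "\<exists>x. (\<exists>K. K-lipschitz_on {0..T} x) \<and>
             sweeping_solution T (moving_polyhedron u b) x0 x \<and>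
             (\<forall>y. (\<exists>K. K-lipschitz_on {0..T} y) \<and>
                  sweeping_solution T (moving_polyhedron u b) x0 y \<longrightarrow>
                  (\<forall>t\<in>{0..T}. y t = x t))"
proof -
  obtain L where L: "L-lipschitz_on {0..T} (\<lambda>t. (u t, b t))" using control_lipschitz by blast
  then have "0 \<le> L" by (rule lipschitz_on_nonneg)
  have ub: "norm (u t - u s) \<le> L * \<bar>t - s\<bar>" "norm (b t - b s) \<le> L * \<bar>t - s\<bar>"
    if "s \<in> {0..T}" "t \<in> {0..T}" for s t
  proof -
    have "dist (u t, b t) (u s, b s) \<le> L * \<bar>t - s\<bar>"
      using lipschitz_onD[OF L that(2) that(1)] by (simp add: dist_real_def)
    then show "norm (u t - u s) \<le> L * \<bar>t - s\<bar>" "norm (b t - b s) \<le> L * \<bar>t - s\<bar>"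
      using dist_fst_le[of "(u t, b t)" "(u s, b s)"] dist_snd_le[of "(u t, b t)" "(u s, b s)"]
      by (auto simp: dist_norm)
  qed
  let ?C = "moving_polyhedron u b"
  \<comment> \<open>Allowing every starting point in \<open>?C a\<close> lets the second piece start
    where the first one ends. The premise makes \<open>P\<close> vacuous on intervals leaving
    \<open>{0..T}\<close>, which the local condition of \<open>Bolzano\<close> also covers.\<close>
  define P where "P a c \<longleftrightarrow> (0 \<le> a \<and> c \<le> T \<longrightarrow> (\<forall>y\<in>?C a. \<exists>x. sweeping_solution_on a c ?C y x))" for a c
  have "P 0 T"
  proof (rule Bolzano)
    show "0 \<le> T" using T_pos by simp
  next
    fix a m c assume P: "P a m" "P m c" and "a \<le> m" "m \<le> c"
    show "P a c"
      unfolding P_def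
    proof (intro impI ballI)
      fix y assume ac: "0 \<le> a \<and> c \<le> T" and y: "y \<in> ?C a"
      then obtain x1 where x1: "sweeping_solution_on a m ?C y x1"
        using P(1) \<open>m \<le> c\<close> by (auto simp: P_def)
      then have "x1 m \<in> ?C m" using \<open>a \<le> m\<close> by (auto simp: sweeping_solution_on_def)
      then obtain x2 where x2: "sweeping_solution_on m c ?C (x1 m) x2"
        using P(2) ac \<open>a \<le> m\<close> by (auto simp: P_def)
      show "\<exists>x. sweeping_solution_on a c ?C y x"
        using sweeping_solution_on_glue[OF x1 x2 \<open>a \<le> m\<close> \<open>m \<le> c\<close>] by blast
    qed
  next
    fix t :: real assume t: "0 \<le> t" "t \<le> T"
    then have "\<exists>z. \<forall>i. u t $ i \<bullet> z < b t $ i"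
      using slater by (simp add: uniform_slater_def)
    then obtain z where z: "\<And>i. u t $ i \<bullet> z < b t $ i" by blast
    obtain \<delta> d where \<delta>: "0 < \<delta>" "0 < d"
      and near: "\<And>s i. s \<in> {0..T} \<Longrightarrow> \<bar>s - t\<bar> < d \<Longrightarrow> u s $ i \<bullet> z \<le> b s $ i - \<delta>"
      using slater_point_locally_common[of "{0..T}" u t L b z] ub t \<open>0 \<le> L\<close> z by auto
    have "P a c" if ac: "a \<le> t" "t \<le> c" "c - a < d" for a c
      unfolding P_def
    proof (intro impI ballI)
      fix y assume "0 \<le> a \<and> c \<le> T" and y: "y \<in> ?C a"
      then show "\<exists>x. sweeping_solution_on a c ?C y x"
        using ac ub near \<delta> \<open>0 \<le> L\<close>
        by (intro sweeping_solution_on_exists_common_slater_point[of a c u L b \<delta> z]) auto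
    qed
    then show "\<exists>d>0. \<forall>a c. a \<le> t \<and> t \<le> c \<and> c - a < d \<longrightarrow> P a c"
      using \<delta>(2) by blast
  qed
  then obtain x where x: "sweeping_solution_on 0 T ?C x0 x"
    using initial by (auto simp: P_def)
  then obtain K E where K: "K-lipschitz_on {0..T} x" and E: "negligible E"
    and E': "\<And>t. t \<in> {0<..<T} - E \<Longrightarrow> \<exists>x'. (x has_vector_derivative x') (at t) \<and> - x' \<in> normal_cone (?C t) (x t)"
    unfolding sweeping_solution_on_def by blast
  have "AE t\<in>{0..T} in lebesgue. \<exists>x'. (x has_vector_derivative x') (at t within {0..T}) \<and> - x' \<in> normal_cone (?C t) (x t)"
  proof (rule AE_I')
    \<comment> \<open>The local notion says nothing about derivatives at the endpoints, so these
      join the null set.\<close>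
    show "E \<union> {0, T} \<in> null_sets lebesgue"
      using E by (simp flip: negligible_iff_null_sets)
    have "\<exists>x'. (x has_vector_derivative x') (at t within {0..T}) \<and> - x' \<in> normal_cone (?C t) (x t)"
      if "t \<in> {0..T}" "t \<notin> E \<union> {0, T}" for t
      using E'[of t] that by (auto intro: has_vector_derivative_at_within)
    then show "{t \<in> space lebesgue. \<not> (t \<in> {0..T} \<longrightarrow> (\<exists>x'. (x has_vector_derivative x') (at t within {0..T}) \<and>
        - x' \<in> normal_cone (?C t) (x t)))} \<subseteq> E \<union> {0, T}"
      by blast
  qed
  then have sol: "sweeping_solution T ?C x0 x"
    using x by (auto simp: sweeping_solution_def sweeping_solution_on_def)
  show ?thesis
    using K sol sweeping_solution_unique[OF K _ sol] by blast
qed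

end
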